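(* Let $\mathcal{H}$ be a reproducing kernel Hilbert space on a non-empty set $\Omega$, and let $A\in\mathcal{B}(\mathcal{H})$. Then for all $r\geq 1$, $$\mathbf{ber}^{2r}(A)\leq \frac{1}{4}\mathbf{ber}\left(|A|^{2r}+|A^*|^{2r}\right)+\frac{1}{2}\mathbf{ber}\left(|A|^r|A^*|^r\right).$$
   Context: Let $\mathbb{F}$ be $\mathbb{R}$ or $\mathbb{C}$ and $\Omega$ a non-empty set. A reproducing kernel Hilbert space $\mathcal{H}$ on $\Omega$ is a Hilbert space over $\mathbb{F}$ consisting of functions $\Omega\to\mathbb{F}$ such that every evaluation $f\mapsto f(\lambda)$, $\lambda\in\Omega$, is bounded. For $\lambda\in\Omega$, $k_\lambda\in\mathcal{H}$ is the unique vector with $f(\lambda)=\langle f,k_\lambda\rangle$ for all $f\in\mathcal{H}$; it is assumed that $k_\lambda\neq 0$ for every $\lambda$, and $\hat{k}_\lambda=k_\lambda/\|k_\lambda\|$. $\mathcal{B}(\mathcal{H})$ is the set of bounded linear operators on $\mathcal{H}$. The Berezin number of $A\in\mathcal{B}(\mathcal{H})$ is $\mathbf{ber}(A)=\sup_{\lambda\in\Omega}|\langle A\hat{k}_\lambda,\hat{k}_\lambda\rangle|$, and $\mathbf{ber}^{s}(A)$ means $(\mathbf{ber}(A))^{s}$. $|A|=(A^*A)^{1/2}$ and $|A^*|=(AA^* )^{1/2}$; real powers of positive operators are taken by the continuous functional calculus. *)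

theory Defs
  imports "HOL-Analysis.Analysis" "HOL-Library.Function_Algebras" "HOL-Computational_Algebra.Polynomial"
begin

text \<open>
  The scalar field is a subset of the complex numbers, either \<open>\<real>\<close> or \<open>UNIV\<close>, so that the real
  and the complex case are treated together.  A function on the set \<open>points H\<close> is represented by
  its extension by zero to the whole type; likewise an operator on \<open>vecs H\<close> is represented by its
  extension by zero.  With these conventions, functions and operators are equal as HOL functions iff
  they agree on \<open>points H\<close> and on \<open>vecs H\<close>, respectively, and both are closed under the pointwise
  sum of \<open>HOL-Library.Function_Algebras\<close>.
\<close>

record 'w function_space =
  scalars :: "complex set"
  points :: "'w set"
  vecs :: "('w \<Rightarrow> complex) set"
  iprod :: "('w \<Rightarrow> complex) \<Rightarrow> ('w \<Rightarrow> complex) \<Rightarrow> complex"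

definition fscale :: "complex \<Rightarrow> ('w \<Rightarrow> complex) \<Rightarrow> 'w \<Rightarrow> complex" where
  "fscale c f = (\<lambda>x. c * f x)"

definition vnorm :: "'w function_space \<Rightarrow> ('w \<Rightarrow> complex) \<Rightarrow> real" where
  "vnorm H f = sqrt (Re (iprod H f f))"

locale function_hilbert_space =
  fixes H :: "'w function_space"
  assumes scalars: "scalars H = \<real> \<or> scalars H = UNIV"
    and vecs_values: "\<And>f x. f \<in> vecs H \<Longrightarrow> x \<in> points H \<Longrightarrow> f x \<in> scalars H"
    and vecs_outside: "\<And>f x. f \<in> vecs H \<Longrightarrow> x \<notin> points H \<Longrightarrow> f x = 0"
    and vecs_zero: "0 \<in> vecs H"
    and vecs_add: "\<And>f g. f \<in> vecs H \<Longrightarrow> g \<in> vecs H \<Longrightarrow> f + g \<in> vecs H"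
    and vecs_scale: "\<And>c f. c \<in> scalars H \<Longrightarrow> f \<in> vecs H \<Longrightarrow> fscale c f \<in> vecs H"
    and iprod_scalar: "\<And>f g. f \<in> vecs H \<Longrightarrow> g \<in> vecs H \<Longrightarrow> iprod H f g \<in> scalars H"
    and iprod_cnj: "\<And>f g. f \<in> vecs H \<Longrightarrow> g \<in> vecs H \<Longrightarrow> iprod H g f = cnj (iprod H f g)"
    and iprod_add: "\<And>f g h. f \<in> vecs H \<Longrightarrow> g \<in> vecs H \<Longrightarrow> h \<in> vecs H \<Longrightarrow>
      iprod H (f + g) h = iprod H f h + iprod H g h"
    and iprod_scale: "\<And>c f g. c \<in> scalars H \<Longrightarrow> f \<in> vecs H \<Longrightarrow> g \<in> vecs H \<Longrightarrow>
      iprod H (fscale c f) g = c * iprod H f g"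
    and iprod_nonneg: "\<And>f. f \<in> vecs H \<Longrightarrow> Re (iprod H f f) \<ge> 0"
    and iprod_definite: "\<And>f. f \<in> vecs H \<Longrightarrow> iprod H f f = 0 \<Longrightarrow> f = 0"
    and complete: "\<And>X :: nat \<Rightarrow> 'w \<Rightarrow> complex. (\<And>n. X n \<in> vecs H) \<Longrightarrow>
      (\<And>e. e > 0 \<Longrightarrow> \<exists>N. \<forall>m\<ge>N. \<forall>n\<ge>N. vnorm H (X m - X n) < e) \<Longrightarrow>
      \<exists>f\<in>vecs H. (\<lambda>n. vnorm H (X n - f)) \<longlonglongrightarrow> 0"

locale rkhs = function_hilbert_space +
  assumes points_nonempty: "points H \<noteq> {}"
    and evaluation_bounded: "\<And>x. x \<in> points H \<Longrightarrow> \<exists>C. \<forall>f\<in>vecs H. cmod (f x) \<le> C * vnorm H f"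

definition repr_kernel :: "'w function_space \<Rightarrow> 'w \<Rightarrow> 'w \<Rightarrow> complex" where
  "repr_kernel H x = (THE k. k \<in> vecs H \<and> (\<forall>f\<in>vecs H. f x = iprod H f k))"

definition normalized_kernel :: "'w function_space \<Rightarrow> 'w \<Rightarrow> 'w \<Rightarrow> complex" where
  "normalized_kernel H x = fscale (complex_of_real (1 / vnorm H (repr_kernel H x))) (repr_kernel H x)"

type_synonym 'w operator = "('w \<Rightarrow> complex) \<Rightarrow> 'w \<Rightarrow> complex"

definition bounded_operators :: "'w function_space \<Rightarrow> 'w operator set" where
  "bounded_operators H = {T.
     (\<forall>f\<in>vecs H. T f \<in> vecs H) \<and> (\<forall>f. f \<notin> vecs H \<longrightarrow> T f = 0) \<and>
     (\<forall>f\<in>vecs H. \<forall>g\<in>vecs H. T (f + g) = T f + T g) \<and>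
     (\<forall>c\<in>scalars H. \<forall>f\<in>vecs H. T (fscale c f) = fscale c (T f)) \<and>
     (\<exists>C. \<forall>f\<in>vecs H. vnorm H (T f) \<le> C * vnorm H f)}"

definition operator_norm :: "'w function_space \<Rightarrow> 'w operator \<Rightarrow> real" where
  "operator_norm H T = (SUP f\<in>{f \<in> vecs H. vnorm H f \<le> 1}. vnorm H (T f))"

definition adj :: "'w function_space \<Rightarrow> 'w operator \<Rightarrow> 'w operator" where
  "adj H T = (THE S. S \<in> bounded_operators H \<and>
     (\<forall>f\<in>vecs H. \<forall>g\<in>vecs H. iprod H (T f) g = iprod H f (S g)))"

definition spectrum :: "'w function_space \<Rightarrow> 'w operator \<Rightarrow> complex set" where
  "spectrum H T = {c \<in> scalars H. \<not> (\<exists>S\<in>bounded_operators H. \<forall>f\<in>vecs H.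
     S (T f - fscale c f) = f \<and> T (S f) - fscale c (S f) = f)}"

definition poly_operator :: "'w function_space \<Rightarrow> real poly \<Rightarrow> 'w operator \<Rightarrow> 'w operator" where
  "poly_operator H p T = (\<lambda>f. if f \<in> vecs H
     then \<Sum>i\<le>degree p. fscale (complex_of_real (coeff p i)) ((T ^^ i) f) else 0)"

text \<open>
  Continuous functional calculus of a self-adjoint \<open>T\<close>, for a real function \<open>\<phi>\<close> continuous on the
  spectrum (which is then real): \<open>\<phi>(T)\<close> is the limit in operator norm of \<open>p\<^sub>n(T)\<close>, for any real
  polynomials \<open>p\<^sub>n\<close> that converge to \<open>\<phi>\<close> uniformly on the spectrum.
\<close>

definition functional_calculus ::
    "'w function_space \<Rightarrow> (real \<Rightarrow> real) \<Rightarrow> 'w operator \<Rightarrow> 'w operator" where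
  "functional_calculus H \<phi> T = (THE S. S \<in> bounded_operators H \<and>
     (\<forall>p. uniform_limit {t. complex_of_real t \<in> spectrum H T} (\<lambda>n. poly (p n)) \<phi> sequentially \<longrightarrow>
        (\<lambda>n. operator_norm H (poly_operator H (p n) T - S)) \<longlonglongrightarrow> 0))"

text \<open>
  For positive operators and exponents \<open>s > 0\<close> only; then \<open>t powr s\<close> is continuous on the spectrum,
  since \<open>0 powr s = 0\<close>.
\<close>

definition operator_powr :: "'w function_space \<Rightarrow> 'w operator \<Rightarrow> real \<Rightarrow> 'w operator" where
  "operator_powr H T s = functional_calculus H (\<lambda>t. t powr s) T"

definition operator_abs :: "'w function_space \<Rightarrow> 'w operator \<Rightarrow> 'w operator" where
  "operator_abs H T = operator_powr H (adj H T \<circ> T) (1 / 2)"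

definition ber :: "'w function_space \<Rightarrow> 'w operator \<Rightarrow> real" where
  "ber H T = (SUP x\<in>points H. cmod (iprod H (T (normalized_kernel H x)) (normalized_kernel H x)))"

end

theory Submission
  imports Defs "HOL-Computational_Algebra.Fundamental_Theorem_Algebra"
begin

text \<open>
  Fix a unit vector \<open>e\<close>, to be thought of as a normalized kernel, and put \<open>P = \<bar>A\<bar>\<^sup>r\<close>, \<open>Q = \<bar>A\<^sup>*\<bar>\<^sup>r\<close>.
  Four inequalities give the estimate at \<open>e\<close>:

  \<^item> the mixed Schwarz inequality \<open>\<bar>\<langle>A e, e\<rangle>\<bar>\<^sup>2 \<le> \<langle>\<bar>A\<bar> e, e\<rangle> \<langle>\<bar>A\<^sup>*\<bar> e, e\<rangle>\<close> (\<open>mixed_Schwarz\<close>);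
  \<^item> McCarthy's inequality \<open>\<langle>T e, e\<rangle>\<^sup>r \<le> \<langle>T\<^sup>r e, e\<rangle>\<close> for positive \<open>T\<close> and \<open>r \<ge> 1\<close> (\<open>McCarthy\<close>), which
    bounds \<open>\<bar>\<langle>A e, e\<rangle>\<bar>\<close> to the power \<open>2 r\<close> by \<open>\<langle>P e, e\<rangle> \<langle>e, Q e\<rangle>\<close>;
  \<^item> Buzano's inequality (\<open>Buzano\<close>), which bounds this product by half of
    \<open>\<parallel>P e\<parallel> \<parallel>Q e\<parallel> + \<bar>\<langle>P e, Q e\<rangle>\<bar>\<close>, where \<open>\<langle>P e, Q e\<rangle>\<close> is conjugate to \<open>\<langle>P Q e, e\<rangle>\<close>;
  \<^item> the arithmetic-geometric mean inequality, which bounds \<open>\<parallel>P e\<parallel> \<parallel>Q e\<parallel>\<close> by half of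
    \<open>\<parallel>P e\<parallel>\<^sup>2 + \<parallel>Q e\<parallel>\<^sup>2 = \<langle>(P\<^sup>2 + Q\<^sup>2) e, e\<rangle>\<close>.

  The theorem is the supremum of this estimate (\<open>quadratic_form_estimate\<close>) over all kernels.

  The powers are given by the continuous functional calculus, so most of the text builds that
  calculus, for real and complex scalars at once.  Its core is the bound
  \<open>\<parallel>p(T)\<parallel> \<le> sup \<bar>p\<bar>\<close> over the real spectrum, for a self-adjoint \<open>T\<close> and a real polynomial \<open>p\<close>
  (\<open>operator_norm_poly_le\<close>).  The proof works over either field: a real polynomial \<open>q\<close> without
  roots in the spectrum is a product of linear factors \<open>t - a\<close> with \<open>a\<close> outside the spectrum and of
  quadratic factors \<open>(t - a)\<^sup>2 + b\<^sup>2\<close> with \<open>b \<noteq> 0\<close>; each factor makes an operator that is bounded below,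
  hence so does \<open>q\<close>.  But \<open>p(T)\<^sup>2 - \<parallel>p(T)\<parallel>\<^sup>2\<close> is not bounded below unless the space is zero, so \<open>p\<^sup>2 - \<parallel>p(T)\<parallel>\<^sup>2\<close> has a
  root in the spectrum.  Weierstrass approximation and completeness then extend \<open>p \<mapsto> p(T)\<close> to
  continuous functions.

  The existence theorems about the Hilbert space all come from one variational argument,
  \<open>coercive_representation\<close>: adjoints, reproducing kernels, and the inverses of \<open>T - t\<close> that confine
  the real spectrum of a positive \<open>T\<close> to the interval from \<open>0\<close> to \<open>\<parallel>T\<parallel>\<close>.
\<close>

section \<open>Geometry of the Hilbert space\<close>

lemma null_sequence_if_bounded:
  fixes X :: "nat \<Rightarrow> 'v::real_normed_vector"
  assumes "b \<longlonglongrightarrow> 0" and "\<And>n. norm (X n) \<le> b n"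
  shows "X \<longlonglongrightarrow> 0"
  by (rule Lim_null_comparison[OF always_eventually assms(1)]) (use assms(2) in blast)

context function_hilbert_space
begin

abbreviation inner_prod (\<open>\<langle>_,/ _\<rangle>\<close>) where "\<langle>f, g\<rangle> \<equiv> iprod H f g"
abbreviation norm_of (\<open>\<parallel>_\<parallel>\<close>) where "\<parallel>f\<parallel> \<equiv> vnorm H f"

lemma of_real_scalar [simp]: "complex_of_real c \<in> scalars H"
  using scalars by (elim disjE) simp_all

lemma zero_mem [simp]: "0 \<in> vecs H"
  by (rule vecs_zero)

lemma add_mem [simp]: "f \<in> vecs H \<Longrightarrow> g \<in> vecs H \<Longrightarrow> f + g \<in> vecs H"
  by (rule vecs_add)

lemma scale_mem [simp]: "c \<in> scalars H \<Longrightarrow> f \<in> vecs H \<Longrightarrow> fscale c f \<in> vecs H"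
  by (rule vecs_scale)

lemma minus_eq_scale: "- f = fscale (complex_of_real (-1)) f"
  by (rule ext) (simp add: fscale_def)

lemma minus_mem [simp]: "f \<in> vecs H \<Longrightarrow> - f \<in> vecs H"
  by (subst minus_eq_scale) (rule scale_mem[OF of_real_scalar])

lemma diff_mem [simp]: "f \<in> vecs H \<Longrightarrow> g \<in> vecs H \<Longrightarrow> f - g \<in> vecs H"
  by (subst diff_conv_add_uminus) (intro add_mem minus_mem)

lemma sum_mem [simp]: "(\<And>i. i \<in> I \<Longrightarrow> X i \<in> vecs H) \<Longrightarrow> (\<Sum>i\<in>I. X i) \<in> vecs H"
  by (induction I rule: infinite_finite_induct) auto

lemma iprod_add_right:
  assumes "f \<in> vecs H" "g \<in> vecs H" "h \<in> vecs H"
  shows "\<langle>h, f + g\<rangle> = \<langle>h, f\<rangle> + \<langle>h, g\<rangle>"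
  using assms iprod_cnj[of "f + g" h] iprod_cnj[of f h] iprod_cnj[of g h] by (simp add: iprod_add)

lemma iprod_scale_right:
  assumes "c \<in> scalars H" "f \<in> vecs H" "g \<in> vecs H"
  shows "\<langle>f, fscale c g\<rangle> = cnj c * \<langle>f, g\<rangle>"
  using assms iprod_cnj[of "fscale c g" f] iprod_cnj[of g f] by (simp add: iprod_scale)

lemma iprod_minus:
  assumes "f \<in> vecs H" "g \<in> vecs H"
  shows "\<langle>- f, g\<rangle> = - \<langle>f, g\<rangle>" "\<langle>f, - g\<rangle> = - \<langle>f, g\<rangle>"
  using assms unfolding minus_eq_scale
  by (simp_all only: iprod_scale iprod_scale_right of_real_scalar) simp_all

lemma iprod_diff:
  assumes "f \<in> vecs H" "g \<in> vecs H" "h \<in> vecs H"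
  shows "\<langle>f - g, h\<rangle> = \<langle>f, h\<rangle> - \<langle>g, h\<rangle>" "\<langle>h, f - g\<rangle> = \<langle>h, f\<rangle> - \<langle>h, g\<rangle>"
proof -
  show "\<langle>f - g, h\<rangle> = \<langle>f, h\<rangle> - \<langle>g, h\<rangle>"
    using assms iprod_add[of f "- g" h] by (simp add: iprod_minus)
  show "\<langle>h, f - g\<rangle> = \<langle>h, f\<rangle> - \<langle>h, g\<rangle>"
    using assms iprod_add_right[of f "- g" h] by (simp add: iprod_minus)
qed

lemma iprod_zero [simp]:
  assumes "f \<in> vecs H"
  shows "\<langle>0, f\<rangle> = 0" "\<langle>f, 0\<rangle> = 0"
  using iprod_diff[of f f f] assms by simp_all

lemmas iprod_linear = iprod_add iprod_add_right iprod_scale iprod_scale_right iprod_minus iprod_diff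

lemma iprod_self:
  assumes "f \<in> vecs H"
  shows "\<langle>f, f\<rangle> = complex_of_real (\<parallel>f\<parallel>\<^sup>2)"
proof -
  have "Im \<langle>f, f\<rangle> = 0"
    using iprod_cnj[OF assms assms] by (simp add: complex_eq_iff)
  then show ?thesis
    using iprod_nonneg[OF assms] by (simp add: complex_eq_iff vnorm_def)
qed

lemma vnorm_squared: "f \<in> vecs H \<Longrightarrow> \<parallel>f\<parallel>\<^sup>2 = Re \<langle>f, f\<rangle>"
  by (simp add: iprod_self)

lemma vnorm_nonneg [simp]: "f \<in> vecs H \<Longrightarrow> 0 \<le> \<parallel>f\<parallel>"
  by (simp add: vnorm_def iprod_nonneg)

lemma vnorm_zero [simp]: "\<parallel>0\<parallel> = 0"
  by (simp add: vnorm_def)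

lemma vnorm_eq_zero: "f \<in> vecs H \<Longrightarrow> \<parallel>f\<parallel> = 0 \<longleftrightarrow> f = 0"
  using iprod_definite iprod_self by fastforce

lemma vnorm_scale:
  assumes "c \<in> scalars H" "f \<in> vecs H"
  shows "\<parallel>fscale c f\<parallel> = cmod c * \<parallel>f\<parallel>"
proof -
  have "\<parallel>fscale c f\<parallel>\<^sup>2 = Re ((c * cnj c) * \<langle>f, f\<rangle>)"
    using assms by (simp add: vnorm_squared iprod_linear mult.assoc mult.commute mult.left_commute)
  also have "\<dots> = (cmod c * \<parallel>f\<parallel>)\<^sup>2"
    using assms by (simp only: iprod_self complex_norm_square[symmetric] power_mult_distrib)
      (simp flip: of_real_power of_real_mult)
  finally show ?thesis
    using assms by simp
qed

lemma vnorm_minus: "f \<in> vecs H \<Longrightarrow> \<parallel>- f\<parallel> = \<parallel>f\<parallel>"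
  by (simp add: vnorm_def iprod_minus)

lemma vnorm_minus_commute:
  assumes "f \<in> vecs H" "g \<in> vecs H"
  shows "\<parallel>f - g\<parallel> = \<parallel>g - f\<parallel>"
  using vnorm_minus[of "g - f"] assms by simp

text \<open>
  The vector \<open>\<parallel>g\<parallel>\<^sup>2 f - \<langle>f, g\<rangle> g\<close> has square norm \<open>\<parallel>g\<parallel>\<^sup>2 (\<parallel>f\<parallel>\<^sup>2 \<parallel>g\<parallel>\<^sup>2 - \<bar>\<langle>f, g\<rangle>\<bar>\<^sup>2)\<close>.
\<close>

lemma Cauchy_Schwarz:
  assumes "f \<in> vecs H" "g \<in> vecs H"
  shows "cmod \<langle>f, g\<rangle> \<le> \<parallel>f\<parallel> * \<parallel>g\<parallel>"
proof (cases "g = 0")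
  case True
  then show ?thesis using assms by simp
next
  case False
  define b where "b = \<parallel>g\<parallel>\<^sup>2"
  define c where "c = \<langle>f, g\<rangle>"
  define h where "h = fscale (complex_of_real b) f - fscale c g"
  have c: "c \<in> scalars H" using assms by (simp add: c_def iprod_scalar)
  have b: "b > 0" using False assms vnorm_eq_zero by (simp add: b_def)
  have gf: "\<langle>g, f\<rangle> = cnj c" using iprod_cnj assms c_def by blast
  have gg: "\<langle>g, g\<rangle> = b" using iprod_self assms b_def by blast
  have cc: "c * cnj c = complex_of_real ((cmod c)\<^sup>2)" by (simp only: complex_norm_square)
  have "\<langle>h, h\<rangle> = b * (b * \<langle>f, f\<rangle>) - b * (c * cnj c)"
    using assms c by (simp add: h_def iprod_linear gf gg c_def[symmetric] algebra_simps)
  also have "\<dots> = complex_of_real (b * (b * \<parallel>f\<parallel>\<^sup>2 - (cmod c)\<^sup>2))"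
    using assms by (simp add: cc iprod_self algebra_simps)
  finally have "0 \<le> b * (b * \<parallel>f\<parallel>\<^sup>2 - (cmod c)\<^sup>2)"
    using iprod_nonneg[of h] assms c by (simp add: h_def)
  then have "(cmod c)\<^sup>2 \<le> b * \<parallel>f\<parallel>\<^sup>2"
    using b by (simp add: zero_le_mult_iff)
  then have "(cmod c)\<^sup>2 \<le> (\<parallel>f\<parallel> * \<parallel>g\<parallel>)\<^sup>2"
    by (simp add: b_def power_mult_distrib mult.commute)
  then show ?thesis
    using assms by (simp add: c_def abs_le_square_iff[symmetric])
qed

lemma Re_iprod_le:
  assumes "f \<in> vecs H" "g \<in> vecs H"
  shows "\<bar>Re \<langle>f, g\<rangle>\<bar> \<le> \<parallel>f\<parallel> * \<parallel>g\<parallel>"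
  using Cauchy_Schwarz[OF assms] abs_Re_le_cmod[of "\<langle>f, g\<rangle>"] by linarith

lemma vnorm_triangle:
  assumes "f \<in> vecs H" "g \<in> vecs H"
  shows "\<parallel>f + g\<parallel> \<le> \<parallel>f\<parallel> + \<parallel>g\<parallel>"
proof -
  have "\<parallel>f + g\<parallel>\<^sup>2 = \<parallel>f\<parallel>\<^sup>2 + \<parallel>g\<parallel>\<^sup>2 + 2 * Re \<langle>f, g\<rangle>"
    using assms iprod_cnj[of f g] by (simp add: vnorm_squared iprod_linear)
  also have "\<dots> \<le> (\<parallel>f\<parallel> + \<parallel>g\<parallel>)\<^sup>2"
    using Re_iprod_le[OF assms] by (simp add: power2_sum)
  finally show ?thesis
    using assms by (meson add_nonneg_nonneg vnorm_nonneg power2_le_imp_le)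
qed

lemma vnorm_triangle_diff:
  assumes "f \<in> vecs H" "g \<in> vecs H" "h \<in> vecs H"
  shows "\<parallel>f - h\<parallel> \<le> \<parallel>f - g\<parallel> + \<parallel>g - h\<parallel>"
  using vnorm_triangle[of "f - g" "g - h"] assms by simp

lemma eq_if_iprod_eq:
  assumes "f \<in> vecs H" "g \<in> vecs H" "\<And>h. h \<in> vecs H \<Longrightarrow> \<langle>h, f\<rangle> = \<langle>h, g\<rangle>"
  shows "f = g"
proof -
  have "\<langle>f - g, f - g\<rangle> = 0"
    using assms by (simp add: iprod_linear)
  then show ?thesis
    using assms iprod_definite[of "f - g"] by simp
qed

subsection \<open>Limits of vectors\<close>

definition vlim :: "(nat \<Rightarrow> 'w \<Rightarrow> complex) \<Rightarrow> ('w \<Rightarrow> complex) \<Rightarrow> bool" where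
  "vlim X f \<longleftrightarrow> (\<forall>n. X n \<in> vecs H) \<and> f \<in> vecs H \<and> (\<lambda>n. \<parallel>X n - f\<parallel>) \<longlonglongrightarrow> 0"

lemma vlim_iprod:
  assumes "vlim X f" "g \<in> vecs H"
  shows "(\<lambda>n. \<langle>X n, g\<rangle>) \<longlonglongrightarrow> \<langle>f, g\<rangle>" "(\<lambda>n. \<langle>g, X n\<rangle>) \<longlonglongrightarrow> \<langle>g, f\<rangle>"
proof -
  note X = assms(1)[unfolded vlim_def]
  have "(\<lambda>n. \<parallel>X n - f\<parallel> * \<parallel>g\<parallel>) \<longlonglongrightarrow> 0"
    using X by (intro tendsto_mult_left_zero) simp
  moreover have "cmod (\<langle>X n, g\<rangle> - \<langle>f, g\<rangle>) \<le> \<parallel>X n - f\<parallel> * \<parallel>g\<parallel>" for n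
    using Cauchy_Schwarz[of "X n - f" g] X assms(2) by (simp add: iprod_linear)
  ultimately have "(\<lambda>n. \<langle>X n, g\<rangle> - \<langle>f, g\<rangle>) \<longlonglongrightarrow> 0"
    by (rule null_sequence_if_bounded)
  then show *: "(\<lambda>n. \<langle>X n, g\<rangle>) \<longlonglongrightarrow> \<langle>f, g\<rangle>"
    by (simp add: LIM_zero_iff)
  have "\<langle>g, f\<rangle> = cnj \<langle>f, g\<rangle>" "\<And>n. \<langle>g, X n\<rangle> = cnj \<langle>X n, g\<rangle>"
    using X assms(2) iprod_cnj by blast+
  then show "(\<lambda>n. \<langle>g, X n\<rangle>) \<longlonglongrightarrow> \<langle>g, f\<rangle>"
    using tendsto_cnj[OF *] by simp
qed

lemma vlim_vnorm:
  assumes "vlim X f"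
  shows "(\<lambda>n. \<parallel>X n\<parallel>) \<longlonglongrightarrow> \<parallel>f\<parallel>"
proof -
  note X = assms[unfolded vlim_def]
  have "(\<lambda>n. \<parallel>X n - f\<parallel>) \<longlonglongrightarrow> 0"
    using X by simp
  moreover have "norm (\<parallel>X n\<parallel> - \<parallel>f\<parallel>) \<le> \<parallel>X n - f\<parallel>" for n
    using vnorm_triangle[of "X n - f" f] vnorm_triangle[of "f - X n" "X n"] X
      vnorm_minus_commute[of f "X n"] by simp
  ultimately have "(\<lambda>n. \<parallel>X n\<parallel> - \<parallel>f\<parallel>) \<longlonglongrightarrow> 0"
    by (rule null_sequence_if_bounded)
  then show ?thesis
    by (simp add: LIM_zero_iff)
qed

lemma vlim_unique:
  assumes "vlim X f" "vlim X g"
  shows "f = g"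
proof (rule eq_if_iprod_eq)
  show "f \<in> vecs H" "g \<in> vecs H"
    using assms by (simp_all add: vlim_def)
  show "\<langle>h, f\<rangle> = \<langle>h, g\<rangle>" if "h \<in> vecs H" for h
    using LIMSEQ_unique[OF vlim_iprod(2)[OF assms(1) that] vlim_iprod(2)[OF assms(2) that]] .
qed

lemma vlim_const [simp]: "f \<in> vecs H \<Longrightarrow> vlim (\<lambda>_. f) f"
  by (simp add: vlim_def)

lemma vlim_add:
  assumes "vlim X f" "vlim Y g"
  shows "vlim (\<lambda>n. X n + Y n) (f + g)"
proof -
  note XY = assms[unfolded vlim_def]
  have "(\<lambda>n. \<parallel>X n - f\<parallel> + \<parallel>Y n - g\<parallel>) \<longlonglongrightarrow> 0"
    using XY by (intro tendsto_add_zero) simp_all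
  moreover have "norm \<parallel>X n + Y n - (f + g)\<parallel> \<le> \<parallel>X n - f\<parallel> + \<parallel>Y n - g\<parallel>" for n
    using vnorm_triangle[of "X n - f" "Y n - g"] XY by (simp add: algebra_simps)
  ultimately have "(\<lambda>n. \<parallel>X n + Y n - (f + g)\<parallel>) \<longlonglongrightarrow> 0"
    by (rule null_sequence_if_bounded)
  then show ?thesis
    using XY by (simp add: vlim_def)
qed

lemma vlim_scale:
  assumes "vlim X f" "c \<in> scalars H"
  shows "vlim (\<lambda>n. fscale c (X n)) (fscale c f)"
proof -
  note X = assms(1)[unfolded vlim_def]
  have eq: "fscale c (X n) - fscale c f = fscale c (X n - f)" for n
    by (rule ext) (simp add: fscale_def algebra_simps)
  have "(\<lambda>n. cmod c * \<parallel>X n - f\<parallel>) \<longlonglongrightarrow> 0"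
    using X by (intro tendsto_mult_right_zero) simp
  then show ?thesis
    using X assms(2) by (simp add: vlim_def eq vnorm_scale)
qed

lemma vlim_diff:
  assumes "vlim X f" "vlim Y g"
  shows "vlim (\<lambda>n. X n - Y n) (f - g)"
  using vlim_add[OF assms(1) vlim_scale[OF assms(2) of_real_scalar[of "-1"]]]
  unfolding minus_eq_scale[symmetric] by simp

lemma vlim_complete:
  assumes "\<And>n. X n \<in> vecs H"
    and "\<And>e. e > 0 \<Longrightarrow> \<exists>N. \<forall>m\<ge>N. \<forall>n\<ge>N. \<parallel>X m - X n\<parallel> < e"
  shows "\<exists>f. vlim X f"
  using complete[of X] assms by (auto simp: vlim_def)

section \<open>Bounded operators\<close>

lemma bo_mem_vecs: "T \<in> bounded_operators H \<Longrightarrow> f \<in> vecs H \<Longrightarrow> T f \<in> vecs H"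
  unfolding bounded_operators_def by blast

lemma bo_outside: "T \<in> bounded_operators H \<Longrightarrow> f \<notin> vecs H \<Longrightarrow> T f = 0"
  unfolding bounded_operators_def by blast

lemma bo_mem: "T \<in> bounded_operators H \<Longrightarrow> T f \<in> vecs H"
  using bo_mem_vecs[of T f] bo_outside[of T f] zero_mem by metis

lemma bo_add:
  "T \<in> bounded_operators H \<Longrightarrow> f \<in> vecs H \<Longrightarrow> g \<in> vecs H \<Longrightarrow> T (f + g) = T f + T g"
  unfolding bounded_operators_def by blast

lemma bo_scale:
  "T \<in> bounded_operators H \<Longrightarrow> c \<in> scalars H \<Longrightarrow> f \<in> vecs H \<Longrightarrow>
    T (fscale c f) = fscale c (T f)"
  unfolding bounded_operators_def by blast

lemma bo_minus: "T \<in> bounded_operators H \<Longrightarrow> f \<in> vecs H \<Longrightarrow> T (- f) = - T f"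
  unfolding minus_eq_scale by (rule bo_scale[OF _ of_real_scalar])

lemma bo_diff:
  assumes "T \<in> bounded_operators H" "f \<in> vecs H" "g \<in> vecs H"
  shows "T (f - g) = T f - T g"
  using bo_add[of T f "- g"] assms by (simp add: bo_minus[OF assms(1)])

lemma bo_zero: "T \<in> bounded_operators H \<Longrightarrow> T 0 = 0"
  using bo_diff[of T 0 0] by simp

text \<open>
  The left sides of these rules are applications of a variable, which match almost every term.  They
  are therefore passed to the simplifier only for a given operator, as \<open>bo_rules[OF T]\<close>.
\<close>

lemmas bo_rules = bo_mem bo_outside bo_zero bo_add bo_diff bo_minus bo_scale

lemma boI:
  assumes "\<And>f. f \<in> vecs H \<Longrightarrow> T f \<in> vecs H"
    and "\<And>f. f \<notin> vecs H \<Longrightarrow> T f = 0"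
    and "\<And>f g. f \<in> vecs H \<Longrightarrow> g \<in> vecs H \<Longrightarrow> T (f + g) = T f + T g"
    and "\<And>c f. c \<in> scalars H \<Longrightarrow> f \<in> vecs H \<Longrightarrow> T (fscale c f) = fscale c (T f)"
    and "\<And>f. f \<in> vecs H \<Longrightarrow> \<parallel>T f\<parallel> \<le> C * \<parallel>f\<parallel>"
  shows "T \<in> bounded_operators H"
  unfolding bounded_operators_def using assms by blast

lemma operator_norm_le:
  assumes "\<And>f. f \<in> vecs H \<Longrightarrow> \<parallel>T f\<parallel> \<le> c * \<parallel>f\<parallel>" and "0 \<le> c"
  shows "operator_norm H T \<le> c"
  unfolding operator_norm_def
proof (rule cSUP_least)
  show "{f \<in> vecs H. \<parallel>f\<parallel> \<le> 1} \<noteq> {}"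
    by (intro exI[of _ 0] ex_in_conv[THEN iffD1]) simp
  show "\<parallel>T f\<parallel> \<le> c" if "f \<in> {f \<in> vecs H. \<parallel>f\<parallel> \<le> 1}" for f
    using assms(1)[of f] mult_left_mono[of "\<parallel>f\<parallel>" 1 c] assms(2) that by simp
qed

lemma operator_norm_bdd:
  assumes "T \<in> bounded_operators H"
  shows "bdd_above ((\<lambda>f. \<parallel>T f\<parallel>) ` {f \<in> vecs H. \<parallel>f\<parallel> \<le> 1})"
proof -
  obtain C where C: "\<And>f. f \<in> vecs H \<Longrightarrow> \<parallel>T f\<parallel> \<le> C * \<parallel>f\<parallel>"
    using assms unfolding bounded_operators_def by blast
  show ?thesis
  proof (rule bdd_aboveI2)
    fix f assume f: "f \<in> {f \<in> vecs H. \<parallel>f\<parallel> \<le> 1}"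
    then have "C * \<parallel>f\<parallel> \<le> \<bar>C\<bar> * 1"
      by (intro mult_mono) auto
    then show "\<parallel>T f\<parallel> \<le> \<bar>C\<bar>"
      using C[of f] f by simp
  qed
qed

lemma operator_norm_nonneg [simp]:
  assumes "T \<in> bounded_operators H"
  shows "0 \<le> operator_norm H T"
  using cSUP_upper[OF _ operator_norm_bdd[OF assms], of 0]
  by (simp add: operator_norm_def bo_rules[OF assms])

lemma operator_norm_bound:
  assumes "T \<in> bounded_operators H" "f \<in> vecs H"
  shows "\<parallel>T f\<parallel> \<le> operator_norm H T * \<parallel>f\<parallel>"
proof (cases "f = 0")
  case True
  then show ?thesis by (simp add: bo_rules[OF assms(1)])
next
  case False
  then have pos: "\<parallel>f\<parallel> > 0"
    using assms vnorm_eq_zero[of f] by (simp add: less_le)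
  let ?c = "complex_of_real (1 / \<parallel>f\<parallel>)"
  have mem: "fscale ?c f \<in> vecs H"
    using assms by (intro scale_mem of_real_scalar)
  have cm: "cmod ?c = 1 / \<parallel>f\<parallel>"
    using pos by (simp add: norm_divide)
  have "\<parallel>fscale ?c f\<parallel> = 1"
    unfolding vnorm_scale[OF of_real_scalar assms(2)] cm using pos by simp
  then have "\<parallel>T (fscale ?c f)\<parallel> \<le> operator_norm H T"
    unfolding operator_norm_def using mem
    by (intro cSUP_upper operator_norm_bdd assms) simp
  moreover have "\<parallel>T (fscale ?c f)\<parallel> = \<parallel>T f\<parallel> / \<parallel>f\<parallel>"
    unfolding bo_scale[OF assms(1) of_real_scalar assms(2)]
      vnorm_scale[OF of_real_scalar bo_mem[OF assms(1)]] cm by simp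
  ultimately have "\<parallel>T f\<parallel> / \<parallel>f\<parallel> \<le> operator_norm H T"
    by (simp only:)
  then show ?thesis
    using pos by (simp only: pos_divide_le_eq)
qed

lemma bo_vlim:
  assumes "T \<in> bounded_operators H" "vlim X f"
  shows "vlim (\<lambda>n. T (X n)) (T f)"
proof -
  note X = assms(2)[unfolded vlim_def]
  have "(\<lambda>n. operator_norm H T * \<parallel>X n - f\<parallel>) \<longlonglongrightarrow> 0"
    using X by (intro tendsto_mult_right_zero) simp
  moreover have "norm \<parallel>T (X n) - T f\<parallel> \<le> operator_norm H T * \<parallel>X n - f\<parallel>" for n
    using operator_norm_bound[OF assms(1), of "X n - f"] X by (simp add: bo_rules[OF assms(1)])
  ultimately have "(\<lambda>n. \<parallel>T (X n) - T f\<parallel>) \<longlonglongrightarrow> 0"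
    by (rule null_sequence_if_bounded)
  then show ?thesis
    using X by (simp add: vlim_def bo_rules[OF assms(1)])
qed

lemma fscale_distribs:
  "fscale c (f + g) = fscale c f + fscale c g"
  "fscale c (f - g) = fscale c f - fscale c g"
  "fscale c (- f) = - fscale c f"
  "fscale c (fscale d f) = fscale (c * d) f"
  "fscale c (0 :: 'x \<Rightarrow> complex) = 0"
  by (rule ext, simp add: fscale_def algebra_simps)+

lemma fscale_0: "fscale 0 f = 0" and fscale_1: "fscale 1 f = f"
  by (rule ext, simp add: fscale_def)+

lemma bo_plus:
  assumes S: "S \<in> bounded_operators H" and T: "T \<in> bounded_operators H"
  shows "S + T \<in> bounded_operators H"
proof (rule boI)
  fix f assume f: "f \<in> vecs H"
  show "\<parallel>(S + T) f\<parallel> \<le> (operator_norm H S + operator_norm H T) * \<parallel>f\<parallel>"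
    using operator_norm_bound[OF S f] operator_norm_bound[OF T f] vnorm_triangle[of "S f" "T f"] f
    by (simp add: distrib_right bo_rules[OF S] bo_rules[OF T])
qed (simp_all add: bo_rules[OF S] bo_rules[OF T] fscale_distribs)

lemma bo_scaled:
  assumes "T \<in> bounded_operators H" "c \<in> scalars H"
  shows "(\<lambda>f. fscale c (T f)) \<in> bounded_operators H"
proof (rule boI)
  fix f assume f: "f \<in> vecs H"
  show "\<parallel>fscale c (T f)\<parallel> \<le> (cmod c * operator_norm H T) * \<parallel>f\<parallel>"
    using mult_left_mono[OF operator_norm_bound[OF assms(1) f], of "cmod c"] f assms(2)
    by (simp add: vnorm_scale mult.assoc bo_rules[OF assms(1)])
qed (use assms(2) in \<open>simp_all add: bo_rules[OF assms(1)] fscale_distribs mult.commute\<close>)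

lemma bo_difference:
  assumes "S \<in> bounded_operators H" "T \<in> bounded_operators H"
  shows "S - T \<in> bounded_operators H"
proof -
  have "S - T = S + (\<lambda>f. fscale (complex_of_real (-1)) (T f))"
    by (rule ext) (simp only: plus_fun_apply minus_apply minus_eq_scale[symmetric] add_uminus_conv_diff)
  then show ?thesis
    using bo_plus[OF assms(1) bo_scaled[OF assms(2) of_real_scalar]] by (simp only:)
qed

lemma bo_comp:
  assumes S: "S \<in> bounded_operators H" and T: "T \<in> bounded_operators H"
  shows "S \<circ> T \<in> bounded_operators H"
proof (rule boI)
  fix f assume f: "f \<in> vecs H"
  show "\<parallel>(S \<circ> T) f\<parallel> \<le> (operator_norm H S * operator_norm H T) * \<parallel>f\<parallel>"
    using operator_norm_bound[OF S, of "T f"] S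
      mult_left_mono[OF operator_norm_bound[OF T f], of "operator_norm H S"]
    by (simp add: mult.assoc bo_rules[OF T])
qed (simp_all add: bo_rules[OF S] bo_rules[OF T])

text \<open>The identity operator, in the representation of operators as zero outside \<open>vecs H\<close>.\<close>

definition restricted_id :: "'w operator" where
  "restricted_id = (\<lambda>f. if f \<in> vecs H then f else 0)"

lemma restricted_id_apply [simp]: "f \<in> vecs H \<Longrightarrow> restricted_id f = f"
  by (simp add: restricted_id_def)

lemma restricted_id_bo [simp]: "restricted_id \<in> bounded_operators H"
  by (rule boI[where C = 1]) (simp_all add: restricted_id_def)

text \<open>
  The limit of a Cauchy sequence is taken pointwise; it is linear and bounded, and the Cauchy
  estimate passes to the limit, which gives convergence in norm.
\<close>

lemma bo_complete:
  assumes T: "\<And>n. T n \<in> bounded_operators H"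
    and Cauchy: "\<And>e. e > 0 \<Longrightarrow> \<exists>N. \<forall>m\<ge>N. \<forall>n\<ge>N. operator_norm H (T m - T n) < e"
  shows "\<exists>S\<in>bounded_operators H. (\<lambda>n. operator_norm H (T n - S)) \<longlonglongrightarrow> 0"
proof -
  have diff_bound: "\<parallel>T m f - T n f\<parallel> \<le> operator_norm H (T m - T n) * \<parallel>f\<parallel>" if "f \<in> vecs H" for m n f
    using operator_norm_bound[OF bo_difference[OF T T] that] by simp
  have "\<exists>g. vlim (\<lambda>n. T n f) g" if f: "f \<in> vecs H" for f
  proof (rule vlim_complete)
    fix e :: real assume e: "e > 0"
    have pos: "\<parallel>f\<parallel> + 1 > 0"
      using vnorm_nonneg[OF f] by linarith
    then obtain N where N: "\<And>m n. m \<ge> N \<Longrightarrow> n \<ge> N \<Longrightarrow> operator_norm H (T m - T n) < e / (\<parallel>f\<parallel> + 1)"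
      using Cauchy[of "e / (\<parallel>f\<parallel> + 1)"] e by auto
    have "\<parallel>T m f - T n f\<parallel> < e" if mn: "m \<ge> N" "n \<ge> N" for m n
    proof -
      have "\<parallel>T m f - T n f\<parallel> \<le> (e / (\<parallel>f\<parallel> + 1)) * \<parallel>f\<parallel>"
        using diff_bound[OF f, of m n] N[OF mn] mult_right_mono[of "operator_norm H (T m - T n)" "e / (\<parallel>f\<parallel> + 1)" "\<parallel>f\<parallel>"] f
        by simp
      also have "\<dots> < e"
        using pos e by (simp add: field_simps)
      finally show ?thesis .
    qed
    then show "\<exists>N. \<forall>m\<ge>N. \<forall>n\<ge>N. \<parallel>T m f - T n f\<parallel> < e" by blast
  qed (rule bo_mem[OF T])
  then obtain S0 where S0: "\<And>f. f \<in> vecs H \<Longrightarrow> vlim (\<lambda>n. T n f) (S0 f)"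
    by metis
  define S where "S f = (if f \<in> vecs H then S0 f else 0)" for f
  have S: "vlim (\<lambda>n. T n f) (S f)" if "f \<in> vecs H" for f
    using S0 that by (simp add: S_def)
  have tail: "\<parallel>T n f - S f\<parallel> \<le> e * \<parallel>f\<parallel>"
    if "f \<in> vecs H" and N: "\<And>m. m \<ge> N \<Longrightarrow> operator_norm H (T n - T m) < e" for f n N e
  proof (rule LIMSEQ_le_const2)
    show "(\<lambda>m. \<parallel>T n f - T m f\<parallel>) \<longlonglongrightarrow> \<parallel>T n f - S f\<parallel>"
      using vlim_vnorm[OF vlim_diff[OF vlim_const S[OF that(1)], of "T n f"]] by (simp add: bo_mem[OF T])
    have "\<parallel>T n f - T m f\<parallel> \<le> e * \<parallel>f\<parallel>" if m: "m \<ge> N" for m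
      using diff_bound[of f n m] N[OF m] mult_right_mono[of "operator_norm H (T n - T m)" e "\<parallel>f\<parallel>"]
        \<open>f \<in> vecs H\<close> by simp
    then show "\<exists>N. \<forall>m\<ge>N. \<parallel>T n f - T m f\<parallel> \<le> e * \<parallel>f\<parallel>" by blast
  qed
  have SBO: "S \<in> bounded_operators H"
  proof -
    obtain N where N: "\<And>m. m \<ge> N \<Longrightarrow> operator_norm H (T N - T m) < 1"
      using Cauchy[of 1] by auto
    show ?thesis
    proof (rule boI)
      fix f g assume fg: "f \<in> vecs H" "g \<in> vecs H"
      show "S (f + g) = S f + S g"
        using S[of "f + g"] vlim_add[OF S[OF fg(1)] S[OF fg(2)]] fg
        by (auto simp: bo_add[OF T] intro: vlim_unique)
    next
      fix c f assume cf: "c \<in> scalars H" "f \<in> vecs H"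
      show "S (fscale c f) = fscale c (S f)"
        using S[of "fscale c f"] vlim_scale[OF S[OF cf(2)] cf(1)] cf
        by (auto simp: bo_scale[OF T] intro: vlim_unique)
    next
      fix f assume f: "f \<in> vecs H"
      show "S f \<in> vecs H"
        using S[OF f] by (simp add: vlim_def)
      then show "\<parallel>S f\<parallel> \<le> (operator_norm H (T N) + 1) * \<parallel>f\<parallel>"
        using vnorm_triangle[of "T N f" "S f - T N f"] tail[OF f N, of N] bo_mem[OF T, of N f]
          operator_norm_bound[OF T f, of N] vnorm_minus_commute[of "S f" "T N f"]
        by (simp add: distrib_right)
    qed (simp add: S_def)
  qed
  have "(\<lambda>n. operator_norm H (T n - S)) \<longlonglongrightarrow> 0"
  proof (rule LIMSEQ_I)
    fix e :: real assume "e > 0"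
    then obtain N where N: "\<And>m n. m \<ge> N \<Longrightarrow> n \<ge> N \<Longrightarrow> operator_norm H (T m - T n) < e / 2"
      using Cauchy[of "e / 2"] by auto
    have "norm (operator_norm H (T n - S) - 0) < e" if n: "n \<ge> N" for n
    proof -
      have "operator_norm H (T n - S) \<le> e / 2"
        using tail[where e = "e / 2" and n = n and N = N] N[OF n] \<open>e > 0\<close>
        by (intro operator_norm_le) auto
      then show ?thesis
        using \<open>e > 0\<close> operator_norm_nonneg[OF bo_difference[OF T SBO]] by simp
    qed
    then show "\<exists>N. \<forall>n\<ge>N. norm (operator_norm H (T n - S) - 0) < e" by blast
  qed
  with SBO show ?thesis by blast
qed

section \<open>Coercive operators, the Riesz theorem and adjoints\<close>

definition self_adjoint :: "'w operator \<Rightarrow> bool" where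
  "self_adjoint T \<longleftrightarrow> T \<in> bounded_operators H \<and>
     (\<forall>f\<in>vecs H. \<forall>g\<in>vecs H. \<langle>T f, g\<rangle> = \<langle>f, T g\<rangle>)"

lemma self_adjointD:
  assumes "self_adjoint T"
  shows "T \<in> bounded_operators H"
    and "f \<in> vecs H \<Longrightarrow> g \<in> vecs H \<Longrightarrow> \<langle>T f, g\<rangle> = \<langle>f, T g\<rangle>"
  using assms by (auto simp: self_adjoint_def)

lemma vlim_iprod_both:
  assumes "vlim X f" "vlim Y g"
  shows "(\<lambda>n. \<langle>X n, Y n\<rangle>) \<longlonglongrightarrow> \<langle>f, g\<rangle>"
proof -
  note XY = assms[unfolded vlim_def]
  have "(\<lambda>n. \<parallel>X n - f\<parallel> * \<parallel>Y n\<parallel>) \<longlonglongrightarrow> 0 * \<parallel>g\<parallel>"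
    using XY vlim_vnorm[OF assms(2)] by (intro tendsto_mult) simp_all
  then have "(\<lambda>n. \<parallel>X n - f\<parallel> * \<parallel>Y n\<parallel>) \<longlonglongrightarrow> 0" by simp
  moreover have "cmod (\<langle>X n, Y n\<rangle> - \<langle>f, Y n\<rangle>) \<le> \<parallel>X n - f\<parallel> * \<parallel>Y n\<parallel>" for n
    using Cauchy_Schwarz[of "X n - f" "Y n"] XY by (simp add: iprod_linear)
  ultimately have "(\<lambda>n. \<langle>X n, Y n\<rangle> - \<langle>f, Y n\<rangle>) \<longlonglongrightarrow> 0"
    by (rule null_sequence_if_bounded)
  from tendsto_add[OF this vlim_iprod(2)[OF assms(2), of f]] XY show ?thesis by simp
qed

lemma Re_self_adjoint_sym:
  assumes "self_adjoint S" "f \<in> vecs H" "g \<in> vecs H"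
  shows "Re \<langle>S f, g\<rangle> = Re \<langle>S g, f\<rangle>"
  using self_adjointD(2)[OF assms] iprod_cnj[of "S g" f] assms
  by (simp add: bo_rules[OF self_adjointD(1)[OF assms(1)]])

text \<open>
  The vector \<open>g\<close> minimizes \<open>J f = \<langle>S f, f\<rangle> - 2 Re (L f)\<close>; the conclusion says that the first variation of
  \<open>J\<close> vanishes at \<open>g\<close>.  Coercivity makes \<open>J\<close> bounded below and, through the parallelogram identity,
  makes every minimizing sequence Cauchy.  The case \<open>S = 1\<close> is the Riesz representation theorem;
  taking \<open>L f = \<langle>f, h\<rangle>\<close> shows that a coercive \<open>S\<close> is surjective.
\<close>

lemma coercive_representation:
  fixes L :: "('w \<Rightarrow> complex) \<Rightarrow> complex"
  assumes S: "self_adjoint S" and c: "c > 0"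
    and coercive: "\<And>f. f \<in> vecs H \<Longrightarrow> c * \<parallel>f\<parallel>\<^sup>2 \<le> Re \<langle>S f, f\<rangle>"
    and L_scalar: "\<And>f. f \<in> vecs H \<Longrightarrow> L f \<in> scalars H"
    and L_add: "\<And>f g. f \<in> vecs H \<Longrightarrow> g \<in> vecs H \<Longrightarrow> L (f + g) = L f + L g"
    and L_scale: "\<And>a f. a \<in> scalars H \<Longrightarrow> f \<in> vecs H \<Longrightarrow> L (fscale a f) = a * L f"
    and L_bound: "\<And>f. f \<in> vecs H \<Longrightarrow> cmod (L f) \<le> C * \<parallel>f\<parallel>"
  shows "\<exists>g\<in>vecs H. \<forall>f\<in>vecs H. L f = \<langle>f, S g\<rangle>"
proof -
  note SB = self_adjointD(1)[OF S]
  note S_sym = Re_self_adjoint_sym[OF S]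
  define J where "J f = Re \<langle>S f, f\<rangle> - 2 * Re (L f)" for f
  have J_lower: "- (C\<^sup>2 / c) \<le> J f" if f: "f \<in> vecs H" for f
  proof -
    have "0 \<le> (c * \<parallel>f\<parallel> - C)\<^sup>2 / c"
      using c by simp
    also have "\<dots> = c * \<parallel>f\<parallel>\<^sup>2 - 2 * (C * \<parallel>f\<parallel>) + C\<^sup>2 / c"
      using c by (simp add: power2_eq_square field_simps)
    also have "\<dots> \<le> J f + C\<^sup>2 / c"
      using coercive[OF f] L_bound[OF f] complex_Re_le_cmod[of "L f"] by (simp add: J_def)
    finally show ?thesis by simp
  qed
  define m where "m = (INF f\<in>vecs H. J f)"
  have bdd: "bdd_below (J ` vecs H)"
    by (rule bdd_belowI2[OF J_lower])
  have m_le: "m \<le> J f" if "f \<in> vecs H" for f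
    unfolding m_def by (rule cINF_lower[OF bdd that])
  have J_along: "J (f + fscale (complex_of_real t) g) =
      J f + 2 * t * (Re \<langle>S f, g\<rangle> - Re (L g)) + t\<^sup>2 * Re \<langle>S g, g\<rangle>"
    if "f \<in> vecs H" "g \<in> vecs H" for f g t
    using that S_sym[of g f]
    by (simp add: J_def L_add L_scale iprod_linear bo_rules[OF SB] algebra_simps power2_eq_square)
  have parallelogram: "c / 2 * \<parallel>f - g\<parallel>\<^sup>2 \<le> J f + J g - 2 * m"
    if fg: "f \<in> vecs H" "g \<in> vecs H" for f g
  proof -
    have mid: "g + fscale (complex_of_real (1 / 2)) (f - g) \<in> vecs H"
      using fg by (intro add_mem scale_mem of_real_scalar diff_mem)
    have "f = g + fscale (complex_of_real 1) (f - g)"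
      by (rule ext) (simp add: fscale_def)
    then have "J f = J g + 2 * (Re \<langle>S g, f - g\<rangle> - Re (L (f - g))) + Re \<langle>S (f - g), f - g\<rangle>"
      using J_along[of g "f - g" 1] fg by simp
    then have "J f + J g - 2 * J (g + fscale (complex_of_real (1 / 2)) (f - g)) =
        Re \<langle>S (f - g), f - g\<rangle> / 2"
      using fg unfolding J_along[OF fg(2) diff_mem[OF fg]] by (simp add: power2_eq_square)
    then show ?thesis
      using m_le[OF mid] coercive[of "f - g"] fg by simp
  qed
  have "vecs H \<noteq> {}"
    using zero_mem by blast
  then have "\<exists>f\<in>vecs H. J f < m + 1 / real (Suc n)" for n
    by (subst cINF_less_iff[OF _ bdd, folded m_def, symmetric]) simp_all
  then obtain X where X: "\<And>n. X n \<in> vecs H" "\<And>n. J (X n) < m + 1 / real (Suc n)"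
    by metis
  have "\<exists>g. vlim X g"
  proof (rule vlim_complete[OF X(1)])
    fix e :: real assume e: "e > 0"
    obtain N where N: "1 / real (Suc N) < c * e\<^sup>2 / 4"
      using reals_Archimedean[of "c * e\<^sup>2 / 4"] c e by (auto simp: inverse_eq_divide)
    have "\<parallel>X i - X j\<parallel> < e" if ij: "i \<ge> N" "j \<ge> N" for i j
    proof -
      have "1 / real (Suc i) \<le> 1 / real (Suc N)" "1 / real (Suc j) \<le> 1 / real (Suc N)"
        using ij by (auto intro!: divide_left_mono)
      then have "c / 2 * \<parallel>X i - X j\<parallel>\<^sup>2 < c / 2 * e\<^sup>2"
        using parallelogram[OF X(1) X(1), of i j] X(2)[of i] X(2)[of j] N by simp
      then show ?thesis
        using c e by (simp add: power_less_imp_less_base)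
    qed
    then show "\<exists>N. \<forall>i\<ge>N. \<forall>j\<ge>N. \<parallel>X i - X j\<parallel> < e" by blast
  qed
  then obtain g where g: "vlim X g" by blast
  then have gV: "g \<in> vecs H" by (simp add: vlim_def)
  have L_diff: "L (f - h) = L f - L h" if "f \<in> vecs H" "h \<in> vecs H" for f h
    using L_add[of "f - h" h] that by simp
  have "(\<lambda>n. C * \<parallel>X n - g\<parallel>) \<longlonglongrightarrow> 0"
    using g by (intro tendsto_mult_right_zero) (simp add: vlim_def)
  moreover have "cmod (L (X n) - L g) \<le> C * \<parallel>X n - g\<parallel>" for n
    using L_bound[of "X n - g"] X(1) gV by (simp add: L_diff)
  ultimately have "(\<lambda>n. L (X n) - L g) \<longlonglongrightarrow> 0"
    by (rule null_sequence_if_bounded)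
  then have L_lim: "(\<lambda>n. L (X n)) \<longlonglongrightarrow> L g"
    by (simp add: LIM_zero_iff)
  have J_lim: "(\<lambda>n. J (X n)) \<longlonglongrightarrow> J g"
    unfolding J_def
    by (intro tendsto_diff tendsto_mult tendsto_const tendsto_Re L_lim vlim_iprod_both bo_vlim[OF SB] g)
  have "J g \<le> m"
  proof (rule LIMSEQ_le[OF J_lim])
    show "(\<lambda>n. m + 1 / real (Suc n)) \<longlonglongrightarrow> m"
      using tendsto_add[OF tendsto_const LIMSEQ_inverse_real_of_nat, of m] by (simp add: inverse_eq_divide)
    show "\<exists>N. \<forall>n\<ge>N. J (X n) \<le> m + 1 / real (Suc n)"
      using X(2) less_imp_le by blast
  qed
  have Re_eq: "Re (L f) = Re \<langle>f, S g\<rangle>" if f: "f \<in> vecs H" for f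
  proof -
    define D where "D = Re \<langle>S g, f\<rangle> - Re (L f)"
    define q where "q = Re \<langle>S f, f\<rangle>"
    \<comment> \<open>The choice \<open>- D / q\<close> would be optimal; adding 1 avoids a vanishing denominator.\<close>
    define t where "t = - D / (q + 1)"
    have q: "q \<ge> 0"
      using coercive[OF f] c zero_le_power2[of "\<parallel>f\<parallel>"] by (simp add: q_def order_trans[rotated])
    have "J g \<le> J (g + fscale (complex_of_real t) f)"
      using \<open>J g \<le> m\<close> m_le[of "g + fscale (complex_of_real t) f"] f gV by simp
    then have "0 \<le> 2 * t * D + t\<^sup>2 * q"
      by (simp add: J_along[OF gV f] D_def q_def)
    also have "\<dots> = - (D\<^sup>2 * (q + 2) / (q + 1)\<^sup>2)"
      using q by (simp add: t_def divide_simps) (simp add: power2_eq_square algebra_simps)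
    finally have "D\<^sup>2 * (q + 2) / (q + 1)\<^sup>2 \<le> 0" by simp
    then have "D = 0"
      using q by (simp add: divide_le_0_iff mult_le_0_iff)
    then show ?thesis
      using iprod_cnj[of f "S g"] f gV by (simp add: D_def bo_rules[OF SB])
  qed
  have "L f = \<langle>f, S g\<rangle>" if f: "f \<in> vecs H" for f
  proof -
    \<comment> \<open>Imaginary parts vanish over the reals; otherwise they are the real parts at \<open>\<i> f\<close>.\<close>
    have "Im (L f) = Im \<langle>f, S g\<rangle>"
    proof (cases "scalars H = \<real>")
      case True
      then show ?thesis
        using L_scalar[OF f] iprod_scalar[of f "S g"] f gV
        by (simp add: complex_is_Real_iff bo_rules[OF SB])
    next
      case False
      then have "\<i> \<in> scalars H"
        using scalars by blast
      then show ?thesis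
        using Re_eq[of "fscale \<i> f"] f gV by (simp add: L_scale iprod_linear bo_rules[OF SB])
    qed
    with Re_eq[OF f] show ?thesis
      by (simp add: complex_eq_iff)
  qed
  then show ?thesis
    using gV by blast
qed

lemma self_adjoint_restricted_id: "self_adjoint restricted_id"
  by (simp add: self_adjoint_def)

lemma Riesz_representation:
  assumes "\<And>f. f \<in> vecs H \<Longrightarrow> L f \<in> scalars H"
    and "\<And>f g. f \<in> vecs H \<Longrightarrow> g \<in> vecs H \<Longrightarrow> L (f + g) = L f + L g"
    and "\<And>a f. a \<in> scalars H \<Longrightarrow> f \<in> vecs H \<Longrightarrow> L (fscale a f) = a * L f"
    and "\<And>f. f \<in> vecs H \<Longrightarrow> cmod (L f) \<le> C * \<parallel>f\<parallel>"
  shows "\<exists>g\<in>vecs H. \<forall>f\<in>vecs H. L f = \<langle>f, g\<rangle>"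
proof -
  have "\<exists>g\<in>vecs H. \<forall>f\<in>vecs H. L f = \<langle>f, restricted_id g\<rangle>"
    by (rule coercive_representation[OF self_adjoint_restricted_id zero_less_one _ assms])
      (simp add: vnorm_squared)
  then show ?thesis by simp
qed

lemma norm_ge_if_coercive:
  assumes "f \<in> vecs H" "g \<in> vecs H" "c * \<parallel>f\<parallel>\<^sup>2 \<le> Re \<langle>g, f\<rangle>"
  shows "c * \<parallel>f\<parallel> \<le> \<parallel>g\<parallel>"
proof (cases "\<parallel>f\<parallel> = 0")
  case False
  have "c * \<parallel>f\<parallel> * \<parallel>f\<parallel> \<le> \<parallel>g\<parallel> * \<parallel>f\<parallel>"
    using assms Re_iprod_le[of g f] by (simp add: power2_eq_square mult.assoc)
  then show ?thesis
    using False vnorm_nonneg[OF assms(1)] by simp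
qed (use assms in simp)

text \<open>
  Representing \<open>f \<mapsto> \<langle>f, h\<rangle>\<close> gives surjectivity; the lower bound \<open>c \<parallel>f\<parallel> \<le> \<parallel>S f\<parallel>\<close> gives injectivity and a
  bounded inverse.
\<close>

lemma coercive_inverse:
  assumes S: "self_adjoint S" and c: "c > 0"
    and coercive: "\<And>f. f \<in> vecs H \<Longrightarrow> c * \<parallel>f\<parallel>\<^sup>2 \<le> Re \<langle>S f, f\<rangle>"
  shows "\<exists>R\<in>bounded_operators H. \<forall>f\<in>vecs H. R (S f) = f \<and> S (R f) = f"
proof -
  note SB = self_adjointD(1)[OF S]
  have "\<exists>g\<in>vecs H. S g = h" if h: "h \<in> vecs H" for h
  proof -
    have "\<exists>g\<in>vecs H. \<forall>f\<in>vecs H. \<langle>f, h\<rangle> = \<langle>f, S g\<rangle>"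
    proof (rule coercive_representation[OF S c coercive])
      show "cmod \<langle>f, h\<rangle> \<le> \<parallel>h\<parallel> * \<parallel>f\<parallel>" if "f \<in> vecs H" for f
        using Cauchy_Schwarz[OF that h] by (simp add: mult.commute)
    qed (use h in \<open>simp_all add: iprod_linear iprod_scalar\<close>)
    then show ?thesis
      using eq_if_iprod_eq[of "S _" h] h bo_mem[OF SB] by metis
  qed
  then obtain R0 where R0: "\<And>h. h \<in> vecs H \<Longrightarrow> R0 h \<in> vecs H \<and> S (R0 h) = h"
    by metis
  have below: "c * \<parallel>f\<parallel> \<le> \<parallel>S f\<parallel>" if "f \<in> vecs H" for f
    by (rule norm_ge_if_coercive[OF that bo_mem[OF SB] coercive[OF that]])
  have inj: "f = g" if "f \<in> vecs H" "g \<in> vecs H" "S f = S g" for f g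
  proof -
    have "c * \<parallel>f - g\<parallel> \<le> 0"
      using below[of "f - g"] that by (simp add: bo_rules[OF SB])
    then have "\<parallel>f - g\<parallel> = 0"
      using c that by (intro antisym) (simp_all add: mult_le_0_iff)
    then show ?thesis
      using that vnorm_eq_zero[of "f - g"] by simp
  qed
  define R where "R h = (if h \<in> vecs H then R0 h else 0)" for h
  have R: "R h \<in> vecs H" "S (R h) = h" if "h \<in> vecs H" for h
    using R0 that by (auto simp: R_def)
  have "R \<in> bounded_operators H"
  proof (rule boI)
    fix f assume f: "f \<in> vecs H"
    show "\<parallel>R f\<parallel> \<le> (1 / c) * \<parallel>f\<parallel>"
      using below[of "R f"] R[OF f] c by (simp add: field_simps)
  next
    fix f g assume "f \<in> vecs H" "g \<in> vecs H"
    then show "R (f + g) = R f + R g"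
      by - (rule inj, simp_all add: R bo_rules[OF SB])
  next
    fix a f assume "a \<in> scalars H" "f \<in> vecs H"
    then show "R (fscale a f) = fscale a (R f)"
      by - (rule inj, simp_all add: R bo_rules[OF SB])
  qed (simp_all add: R(1), simp add: R_def)
  moreover have "R (S f) = f" if f: "f \<in> vecs H" for f
    using R[of "S f"] f by - (rule inj, simp_all add: bo_mem[OF SB])
  ultimately show ?thesis
    using R by blast
qed

lemma adjoint_exists:
  assumes T: "T \<in> bounded_operators H"
  shows "\<exists>S\<in>bounded_operators H. \<forall>f\<in>vecs H. \<forall>g\<in>vecs H. \<langle>T f, g\<rangle> = \<langle>f, S g\<rangle>"
proof -
  have bound: "cmod \<langle>T f, g\<rangle> \<le> (operator_norm H T * \<parallel>g\<parallel>) * \<parallel>f\<parallel>"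
    if "f \<in> vecs H" "g \<in> vecs H" for f g
    using Cauchy_Schwarz[of "T f" g] mult_right_mono[OF operator_norm_bound[OF T that(1)], of "\<parallel>g\<parallel>"] that
    by (simp add: bo_rules[OF T] mult_ac)
  have "\<exists>h\<in>vecs H. \<forall>f\<in>vecs H. \<langle>T f, g\<rangle> = \<langle>f, h\<rangle>" if g: "g \<in> vecs H" for g
    by (rule Riesz_representation[OF _ _ _ bound])
      (use g in \<open>simp_all add: bo_rules[OF T] iprod_linear iprod_scalar\<close>)
  then obtain S0 where S0: "\<And>g. g \<in> vecs H \<Longrightarrow> S0 g \<in> vecs H \<and> (\<forall>f\<in>vecs H. \<langle>T f, g\<rangle> = \<langle>f, S0 g\<rangle>)"
    by metis
  define S where "S h = (if h \<in> vecs H then S0 h else 0)" for h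
  have S: "S g \<in> vecs H" "f \<in> vecs H \<Longrightarrow> \<langle>f, S g\<rangle> = \<langle>T f, g\<rangle>" if "g \<in> vecs H" for f g
    using S0 that by (auto simp: S_def)
  have "S \<in> bounded_operators H"
  proof (rule boI)
    fix g assume g: "g \<in> vecs H"
    have "\<parallel>S g\<parallel> * \<parallel>S g\<parallel> \<le> operator_norm H T * \<parallel>g\<parallel> * \<parallel>S g\<parallel>"
      using bound[of "S g" g] S(1)[OF g] S(2)[OF g S(1)[OF g]] g vnorm_squared[of "S g"] complex_Re_le_cmod[of "\<langle>S g, S g\<rangle>"]
      by (simp add: power2_eq_square)
    then show "\<parallel>S g\<parallel> \<le> operator_norm H T * \<parallel>g\<parallel>"
      using S(1)[OF g] vnorm_nonneg[OF S(1)[OF g]] operator_norm_nonneg[OF T] vnorm_nonneg[OF g]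
      by (cases "\<parallel>S g\<parallel> = 0") simp_all
  next
    fix f g assume "f \<in> vecs H" "g \<in> vecs H"
    then show "S (f + g) = S f + S g"
      by - (rule eq_if_iprod_eq, simp_all add: S iprod_linear bo_rules[OF T])
  next
    fix c g assume "c \<in> scalars H" "g \<in> vecs H"
    then show "S (fscale c g) = fscale c (S g)"
      by - (rule eq_if_iprod_eq, simp_all add: S iprod_linear bo_rules[OF T])
  qed (use S(1) in \<open>simp_all add: S_def\<close>)
  then show ?thesis
    using S by metis
qed

lemma adjoint_unique:
  assumes "S \<in> bounded_operators H" "R \<in> bounded_operators H"
    and "\<And>f g. f \<in> vecs H \<Longrightarrow> g \<in> vecs H \<Longrightarrow> \<langle>f, S g\<rangle> = \<langle>f, R g\<rangle>"
  shows "S = R"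
proof
  fix g show "S g = R g"
  proof (cases "g \<in> vecs H")
    case True
    then show ?thesis
      using assms by - (rule eq_if_iprod_eq, simp_all add: bo_mem)
  qed (simp add: bo_outside assms)
qed

lemma adj:
  assumes T: "T \<in> bounded_operators H"
  shows "adj H T \<in> bounded_operators H"
    and "f \<in> vecs H \<Longrightarrow> g \<in> vecs H \<Longrightarrow> \<langle>f, adj H T g\<rangle> = \<langle>T f, g\<rangle>"
    and "f \<in> vecs H \<Longrightarrow> g \<in> vecs H \<Longrightarrow> \<langle>adj H T f, g\<rangle> = \<langle>f, T g\<rangle>"
proof -
  let ?P = "\<lambda>S. S \<in> bounded_operators H \<and> (\<forall>f\<in>vecs H. \<forall>g\<in>vecs H. \<langle>T f, g\<rangle> = \<langle>f, S g\<rangle>)"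
  have "\<exists>!S. ?P S"
  proof (rule ex_ex1I)
    show "\<exists>S. ?P S" using adjoint_exists[OF T] by blast
    show "S = R" if "?P S" "?P R" for S R
      by (rule adjoint_unique) (use that in auto)
  qed
  then have P: "?P (adj H T)"
    unfolding adj_def by (rule theI')
  then show B: "adj H T \<in> bounded_operators H"
    and "f \<in> vecs H \<Longrightarrow> g \<in> vecs H \<Longrightarrow> \<langle>f, adj H T g\<rangle> = \<langle>T f, g\<rangle>"
    by auto
  show "\<langle>adj H T f, g\<rangle> = \<langle>f, T g\<rangle>" if "f \<in> vecs H" "g \<in> vecs H"
    using P that iprod_cnj[of f "T g"] iprod_cnj[of g "adj H T f"] iprod_cnj[of "T g" f]
    by (simp add: bo_rules[OF T] bo_rules[OF B])
qed

lemma adj_adj: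
  assumes T: "T \<in> bounded_operators H"
  shows "adj H (adj H T) = T"
  by (rule adjoint_unique) (simp_all add: adj T)

section \<open>Location of the spectrum\<close>

abbreviation real_spectrum :: "'w operator \<Rightarrow> real set" where
  "real_spectrum T \<equiv> {t. complex_of_real t \<in> spectrum H T}"

lemma not_in_real_spectrum:
  assumes "R \<in> bounded_operators H"
    and "\<And>f. f \<in> vecs H \<Longrightarrow>
      R (T f - fscale (complex_of_real t) f) = f \<and> T (R f) - fscale (complex_of_real t) (R f) = f"
  shows "t \<notin> real_spectrum T"
proof -
  have "\<exists>S\<in>bounded_operators H. \<forall>f\<in>vecs H.
      S (T f - fscale (complex_of_real t) f) = f \<and> T (S f) - fscale (complex_of_real t) (S f) = f"
    by (rule bexI[OF _ assms(1)], rule ballI, rule assms(2))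
  then show ?thesis
    unfolding spectrum_def mem_Collect_eq by (intro notI) (elim conjE notE)
qed

text \<open>
  For \<open>t < m\<close> the operator \<open>T - t\<close> is coercive, hence invertible.
\<close>

lemma real_spectrum_lower:
  assumes T: "self_adjoint T"
    and lower: "\<And>f. f \<in> vecs H \<Longrightarrow> m * \<parallel>f\<parallel>\<^sup>2 \<le> Re \<langle>T f, f\<rangle>"
    and t: "t \<in> real_spectrum T"
  shows "m \<le> t"
proof (rule ccontr)
  assume "\<not> m \<le> t"
  then have pos: "m - t > 0" by simp
  note TB = self_adjointD(1)[OF T]
  let ?S = "T - (\<lambda>f. fscale (complex_of_real t) (restricted_id f))"
  have "self_adjoint ?S"
    unfolding self_adjoint_def using bo_difference[OF TB bo_scaled[OF restricted_id_bo of_real_scalar]]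
    by (simp add: iprod_linear bo_rules[OF TB] self_adjointD(2)[OF T])
  moreover have "(m - t) * \<parallel>f\<parallel>\<^sup>2 \<le> Re \<langle>?S f, f\<rangle>" if "f \<in> vecs H" for f
    using lower[OF that] that by (simp add: iprod_linear bo_rules[OF TB] vnorm_squared algebra_simps)
  ultimately have "\<exists>R\<in>bounded_operators H. \<forall>f\<in>vecs H. R (?S f) = f \<and> ?S (R f) = f"
    by (rule coercive_inverse[OF _ pos])
  then obtain R where R: "R \<in> bounded_operators H" "\<And>f. f \<in> vecs H \<Longrightarrow> R (?S f) = f \<and> ?S (R f) = f"
    by blast
  then have "R (T f - fscale (complex_of_real t) f) = f \<and> T (R f) - fscale (complex_of_real t) (R f) = f"
    if "f \<in> vecs H" for f
    using R(2)[OF that] that by (simp add: bo_rules[OF R(1)])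
  with R(1) have "t \<notin> real_spectrum T"
    by (rule not_in_real_spectrum)
  with t show False by contradiction
qed

text \<open>
  For \<open>t > \<parallel>T\<parallel>\<close> the operator \<open>t - T\<close> is coercive, hence invertible.
\<close>

lemma real_spectrum_upper:
  assumes T: "self_adjoint T" and t: "t \<in> real_spectrum T"
  shows "t \<le> operator_norm H T"
proof (rule ccontr)
  assume "\<not> t \<le> operator_norm H T"
  then have pos: "t - operator_norm H T > 0" by simp
  note TB = self_adjointD(1)[OF T]
  let ?S = "(\<lambda>f. fscale (complex_of_real t) (restricted_id f)) - T"
  have "self_adjoint ?S"
    unfolding self_adjoint_def using bo_difference[OF bo_scaled[OF restricted_id_bo of_real_scalar] TB]
    by (simp add: iprod_linear bo_rules[OF TB] self_adjointD(2)[OF T])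
  moreover have "(t - operator_norm H T) * \<parallel>f\<parallel>\<^sup>2 \<le> Re \<langle>?S f, f\<rangle>" if "f \<in> vecs H" for f
    using Re_iprod_le[of "T f" f] mult_right_mono[OF operator_norm_bound[OF TB that], of "\<parallel>f\<parallel>"] that
    by (simp add: iprod_linear bo_rules[OF TB] iprod_self algebra_simps power2_eq_square)
  ultimately have "\<exists>R\<in>bounded_operators H. \<forall>f\<in>vecs H. R (?S f) = f \<and> ?S (R f) = f"
    by (rule coercive_inverse[OF _ pos])
  then obtain R where R: "R \<in> bounded_operators H" "\<And>f. f \<in> vecs H \<Longrightarrow> R (?S f) = f \<and> ?S (R f) = f"
    by blast
  let ?R = "\<lambda>f. fscale (complex_of_real (-1)) (R f)"
  have "?R (T f - fscale (complex_of_real t) f) = f \<and> T (?R f) - fscale (complex_of_real t) (?R f) = f"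
    if f: "f \<in> vecs H" for f
  proof
    have "T f - fscale (complex_of_real t) f = - ?S f" using f by simp
    then have "R (T f - fscale (complex_of_real t) f) = - f"
      using R(2)[OF f] bo_minus[OF R(1), of "?S f"] f by (simp add: bo_rules[OF TB])
    then show "?R (T f - fscale (complex_of_real t) f) = f"
      unfolding minus_eq_scale[symmetric] by simp
    have Rf: "R f \<in> vecs H" using R(1) by (simp add: bo_mem)
    have "T (?R f) - fscale (complex_of_real t) (?R f) = ?S (R f)"
      unfolding minus_eq_scale[symmetric] using Rf by (simp add: bo_rules[OF TB] fscale_distribs)
    then show "T (?R f) - fscale (complex_of_real t) (?R f) = f"
      using R(2)[OF f] by simp
  qed
  with bo_scaled[OF R(1) of_real_scalar] have "t \<notin> real_spectrum T"
    by (rule not_in_real_spectrum)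
  with t show False by contradiction
qed

end

section \<open>Real polynomials and their complex roots\<close>

definition complex_value :: "real poly \<Rightarrow> complex \<Rightarrow> complex" where
  "complex_value p = poly (map_poly complex_of_real p)"

lemma complex_value_0 [simp]: "complex_value 0 z = 0"
  by (simp add: complex_value_def)

lemma complex_value_pCons [simp]:
  "complex_value (pCons a p) z = complex_of_real a + z * complex_value p z"
  by (cases "pCons a p = 0") (simp_all add: complex_value_def map_poly_pCons)

lemma complex_value_add: "complex_value (p + q) z = complex_value p z + complex_value q z"
  by (induction p q rule: poly_induct2) (simp_all add: algebra_simps)

lemma complex_value_smult: "complex_value (smult c p) z = complex_of_real c * complex_value p z"
  by (induction p) (simp_all add: algebra_simps)

lemma complex_value_mult: "complex_value (p * q) z = complex_value p z * complex_value q z"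
  by (induction p) (simp_all add: complex_value_add complex_value_smult algebra_simps)

lemma complex_value_of_real: "complex_value p (complex_of_real t) = complex_of_real (poly p t)"
  by (induction p) simp_all

lemma complex_root_exists:
  assumes "degree p > 0"
  shows "\<exists>z. complex_value p z = 0"
proof -
  have "degree (map_poly complex_of_real p) = degree p"
    by (rule map_poly_degree_eq) (use assms in auto)
  then show ?thesis
    unfolding complex_value_def
    using assms by (intro fundamental_theorem_of_algebra) (simp add: constant_degree)
qed

text \<open>
  The remainder of \<open>p\<close> modulo the quadratic is a real polynomial \<open>u + v t\<close> that vanishes at the
  nonreal number \<open>z\<close>, hence is zero.
\<close>

lemma quadratic_factor:
  assumes "complex_value p z = 0" "Im z \<noteq> 0"
  shows "[:(Re z)\<^sup>2 + (Im z)\<^sup>2, - 2 * Re z, 1:] dvd p"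
proof -
  define d where "d = [:(Re z)\<^sup>2 + (Im z)\<^sup>2, - 2 * Re z, 1:]"
  have d0: "complex_value d z = 0"
    by (simp add: d_def complex_eq_iff power2_eq_square algebra_simps)
  have "degree (p mod d) < 2"
    using degree_mod_less[of d p] by (auto simp: d_def)
  then have "degree (p mod d) \<le> 1" by simp
  then obtain u v where uv: "p mod d = [:u, v:]"
    by (metis degree_eq_zeroE degree_pCons_eq_if le_zero_eq nat_le_iff_add not_less_eq_eq One_nat_def pCons_cases pCons_0_0 Suc_le_mono)
  have "complex_value p z = complex_value (p div d * d + p mod d) z"
    by (simp only: div_mult_mod_eq)
  then have "complex_of_real u + z * complex_of_real v = 0"
    using assms(1) d0 by (simp add: complex_value_add complex_value_mult uv)
  then have "v = 0" "u = 0"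
    using assms(2) by (auto simp: complex_eq_iff)
  then have "p mod d = 0" by (simp add: uv)
  then show ?thesis
    unfolding d_def[symmetric] by (rule mod_0_imp_dvd)
qed

text \<open>
  Used as simplification rules, these turn equations between vectors into equations between values
  and so hide the vector operations that the rules for operators refer to.
\<close>

lemmas fun_apply = plus_fun_apply zero_fun_apply minus_apply

declare fun_apply [simp del]

context function_hilbert_space
begin

section \<open>Polynomials in an operator\<close>

lemma power_mem: "T \<in> bounded_operators H \<Longrightarrow> f \<in> vecs H \<Longrightarrow> (T ^^ i) f \<in> vecs H"
  by (cases i) (simp_all add: bo_mem)

lemma bo_sum:
  assumes T: "T \<in> bounded_operators H" and X: "\<And>i. i \<in> I \<Longrightarrow> X i \<in> vecs H"
  shows "T (\<Sum>i\<in>I. X i) = (\<Sum>i\<in>I. T (X i))"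
  using X by (induction I rule: infinite_finite_induct) (simp_all add: bo_rules[OF T])

lemma poly_operator_extend:
  assumes "f \<in> vecs H" "degree p \<le> n"
  shows "poly_operator H p T f = (\<Sum>i\<le>n. fscale (complex_of_real (coeff p i)) ((T ^^ i) f))"
proof -
  have "fscale (complex_of_real (coeff p i)) ((T ^^ i) f) = 0" if "i \<in> {..n} - {..degree p}" for i
    using that by (intro ext) (simp add: fscale_def coeff_eq_0 fun_apply)
  then show ?thesis
    unfolding poly_operator_def using assms
    by (simp, intro sum.mono_neutral_left) auto
qed

lemma poly_operator_outside [simp]: "f \<notin> vecs H \<Longrightarrow> poly_operator H p T f = 0"
  by (simp add: poly_operator_def)

lemma poly_operator_0 [simp]: "poly_operator H 0 T f = 0"
  by (rule ext) (simp add: poly_operator_def fscale_def fun_apply)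

lemma poly_operator_pCons:
  assumes T: "T \<in> bounded_operators H" and f: "f \<in> vecs H"
  shows "poly_operator H (pCons a p) T f = fscale (complex_of_real a) f + T (poly_operator H p T f)"
proof -
  have "degree (pCons a p) \<le> Suc (degree p)"
    by (rule degree_pCons_le)
  from poly_operator_extend[OF f this, of T]
  have "poly_operator H (pCons a p) T f = fscale (complex_of_real a) f +
      (\<Sum>i\<le>degree p. fscale (complex_of_real (coeff p i)) (T ((T ^^ i) f)))"
    by (simp add: sum.atMost_Suc_shift del: sum.atMost_Suc)
  also have "(\<Sum>i\<le>degree p. fscale (complex_of_real (coeff p i)) (T ((T ^^ i) f))) =
      T (\<Sum>i\<le>degree p. fscale (complex_of_real (coeff p i)) ((T ^^ i) f))"
    by (subst bo_sum[OF T]) (simp_all add: power_mem[OF T f] bo_scale[OF T])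
  finally show ?thesis
    using f by (simp add: poly_operator_def[of H p T])
qed

lemma poly_operator_bo:
  assumes T: "T \<in> bounded_operators H"
  shows "poly_operator H p T \<in> bounded_operators H"
proof (induction p)
  case 0
  show ?case by (rule boI[where C = 0]) (simp_all add: fscale_distribs)
next
  case (pCons a p)
  have "poly_operator H (pCons a p) T =
      (\<lambda>f. fscale (complex_of_real a) (restricted_id f)) + (T \<circ> poly_operator H p T)"
  proof
    fix f show "poly_operator H (pCons a p) T f =
      ((\<lambda>f. fscale (complex_of_real a) (restricted_id f)) + (T \<circ> poly_operator H p T)) f"
      by (cases "f \<in> vecs H")
        (simp_all add: poly_operator_pCons[OF T] restricted_id_def fscale_distribs bo_zero[OF T] fun_apply(1))
  qed
  then show ?case
    using bo_plus[OF bo_scaled[OF restricted_id_bo of_real_scalar] bo_comp[OF T pCons.IH]] by (simp only:)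
qed

lemma poly_operator_mem [simp]:
  "T \<in> bounded_operators H \<Longrightarrow> poly_operator H p T f \<in> vecs H"
  by (rule bo_mem[OF poly_operator_bo])

lemma poly_operator_add:
  assumes T: "T \<in> bounded_operators H" and f: "f \<in> vecs H"
  shows "poly_operator H (p + q) T f = poly_operator H p T f + poly_operator H q T f"
proof -
  let ?n = "max (degree p) (degree q)"
  have "degree (p + q) \<le> ?n" by (rule degree_add_le_max)
  note sums = poly_operator_extend[OF f this, of T]
    poly_operator_extend[OF f max.cobounded1, of p T "degree q"]
    poly_operator_extend[OF f max.cobounded2, of q T "degree p"]
  have "fscale (complex_of_real (coeff (p + q) i)) g =
      fscale (complex_of_real (coeff p i)) g + fscale (complex_of_real (coeff q i)) g" for i and g :: "'w \<Rightarrow> complex"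
    by (rule ext) (simp add: fscale_def algebra_simps fun_apply)
  then show ?thesis
    unfolding sums by (simp only: sum.distrib)
qed

lemma poly_operator_smult:
  assumes T: "T \<in> bounded_operators H" and f: "f \<in> vecs H"
  shows "poly_operator H (smult c p) T f = fscale (complex_of_real c) (poly_operator H p T f)"
  using f by (induction p)
    (simp_all add: poly_operator_pCons[OF T] fscale_distribs bo_rules[OF T] T)

lemma poly_operator_diff:
  assumes T: "T \<in> bounded_operators H" and f: "f \<in> vecs H"
  shows "poly_operator H (p - q) T f = poly_operator H p T f - poly_operator H q T f"
  using poly_operator_add[OF T f, of "p - q" q] by (simp add: algebra_simps)

lemma poly_operator_mult:
  assumes T: "T \<in> bounded_operators H" and f: "f \<in> vecs H"
  shows "poly_operator H (p * q) T f = poly_operator H p T (poly_operator H q T f)"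
proof (induction p)
  case 0
  then show ?case by simp
next
  case (pCons a p)
  then show ?case
    using f by (simp add: poly_operator_add poly_operator_smult poly_operator_pCons T fscale_distribs)
      (rule ext, simp add: fscale_def fun_apply)
qed

lemma poly_operator_const:
  assumes T: "T \<in> bounded_operators H" and f: "f \<in> vecs H"
  shows "poly_operator H [:c:] T f = fscale (complex_of_real c) f"
  by (simp add: poly_operator_pCons[OF T f] bo_zero[OF T])

lemma poly_operator_linear:
  assumes T: "T \<in> bounded_operators H" and f: "f \<in> vecs H"
  shows "poly_operator H [:c, d:] T f = fscale (complex_of_real c) f + fscale (complex_of_real d) (T f)"
  by (simp add: poly_operator_pCons[OF T f] poly_operator_const[OF T f] bo_scale[OF T _ f] bo_zero[OF T])

text \<open>
  With \<open>A = S = T\<close>, this says that \<open>T\<close> commutes with \<open>p(T)\<close>; with \<open>S = A\<^sup>* A\<close> and \<open>T = A A\<^sup>*\<close>, it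
  moves \<open>A\<close> past functions of \<open>A\<^sup>* A\<close>.
\<close>

lemma poly_operator_intertwine:
  assumes A: "A \<in> bounded_operators H" and S: "S \<in> bounded_operators H" and T: "T \<in> bounded_operators H"
    and comm: "\<And>f. f \<in> vecs H \<Longrightarrow> T (A f) = A (S f)" and f: "f \<in> vecs H"
  shows "poly_operator H p T (A f) = A (poly_operator H p S f)"
  by (induction p)
    (simp_all add: poly_operator_pCons[OF S f] poly_operator_pCons[OF T bo_mem[OF A]] bo_zero[OF A]
      bo_add[OF A] bo_scale[OF A] f bo_mem[OF S] S comm)

lemma poly_operator_self_adjoint:
  assumes T: "self_adjoint T"
  shows "self_adjoint (poly_operator H p T)"
proof -
  note TB = self_adjointD(1)[OF T]
  have "\<langle>poly_operator H p T f, g\<rangle> = \<langle>f, poly_operator H p T g\<rangle>" if "f \<in> vecs H" "g \<in> vecs H" for f g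
    using that
  proof (induction p arbitrary: g)
    case (pCons a p)
    then show ?case
      by (simp add: poly_operator_pCons[OF TB] iprod_linear TB bo_mem[OF TB] self_adjointD(2)[OF T]
          poly_operator_intertwine[OF TB TB TB refl])
  qed simp
  then show ?thesis
    by (simp add: self_adjoint_def poly_operator_bo[OF TB])
qed

section \<open>The spectral bound for polynomials\<close>

definition bounded_below :: "'w operator \<Rightarrow> bool" where
  "bounded_below T \<longleftrightarrow> (\<exists>c>0. \<forall>f\<in>vecs H. c * \<parallel>f\<parallel> \<le> \<parallel>T f\<parallel>)"

lemma bounded_below_poly_mult:
  assumes T: "T \<in> bounded_operators H"
    and "bounded_below (poly_operator H p T)" "bounded_below (poly_operator H q T)"
  shows "bounded_below (poly_operator H (p * q) T)"
proof -
  obtain c d where c: "c > 0" "\<And>f. f \<in> vecs H \<Longrightarrow> c * \<parallel>f\<parallel> \<le> \<parallel>poly_operator H p T f\<parallel>"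
    and d: "d > 0" "\<And>f. f \<in> vecs H \<Longrightarrow> d * \<parallel>f\<parallel> \<le> \<parallel>poly_operator H q T f\<parallel>"
    using assms(2,3) unfolding bounded_below_def by blast
  have "c * d * \<parallel>f\<parallel> \<le> \<parallel>poly_operator H (p * q) T f\<parallel>" if f: "f \<in> vecs H" for f
  proof -
    have "c * (d * \<parallel>f\<parallel>) \<le> c * \<parallel>poly_operator H q T f\<parallel>"
      using d(2)[OF f] c(1) by simp
    also have "\<dots> \<le> \<parallel>poly_operator H (p * q) T f\<parallel>"
      using c(2) f by (simp add: poly_operator_mult T)
    finally show ?thesis by (simp add: mult.assoc)
  qed
  then show ?thesis
    unfolding bounded_below_def using c(1) d(1) by (intro exI[of _ "c * d"]) simp
qed

lemma bounded_below_linear: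
  assumes T: "self_adjoint T" and t: "t \<notin> real_spectrum T"
  shows "bounded_below (poly_operator H [:- t, 1:] T)"
proof -
  note TB = self_adjointD(1)[OF T]
  obtain R where R: "R \<in> bounded_operators H"
    "\<And>f. f \<in> vecs H \<Longrightarrow> R (T f - fscale (complex_of_real t) f) = f"
    using t unfolding spectrum_def by auto
  have eq: "poly_operator H [:- t, 1:] T f = T f - fscale (complex_of_real t) f" if "f \<in> vecs H" for f
    unfolding poly_operator_linear[OF TB that] by (rule ext) (simp add: fscale_def fun_apply)
  have "1 / (operator_norm H R + 1) * \<parallel>f\<parallel> \<le> \<parallel>poly_operator H [:- t, 1:] T f\<parallel>" if f: "f \<in> vecs H" for f
  proof -
    let ?g = "T f - fscale (complex_of_real t) f"
    have g: "?g \<in> vecs H" using f by (simp add: bo_mem[OF TB])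
    have "\<parallel>f\<parallel> \<le> operator_norm H R * \<parallel>?g\<parallel>"
      using operator_norm_bound[OF R(1) g] R(2)[OF f] by simp
    also have "\<dots> \<le> (operator_norm H R + 1) * \<parallel>?g\<parallel>"
      using vnorm_nonneg[OF g] by (simp add: distrib_right)
    finally show ?thesis
      unfolding eq[OF f] using operator_norm_nonneg[OF R(1)]
      by (simp add: pos_divide_le_eq mult.commute add_nonneg_pos)
  qed
  moreover have "0 < 1 / (operator_norm H R + 1)"
    using operator_norm_nonneg[OF R(1)] by (simp add: add_nonneg_pos)
  ultimately show ?thesis
    unfolding bounded_below_def by blast
qed

text \<open>
  For self-adjoint \<open>T\<close>, \<open>\<langle>((T - a)\<^sup>2 + b\<^sup>2) f, f\<rangle> = \<parallel>(T - a) f\<parallel>\<^sup>2 + b\<^sup>2 \<parallel>f\<parallel>\<^sup>2\<close>.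
\<close>

lemma bounded_below_quadratic:
  assumes T: "self_adjoint T" and b: "b \<noteq> 0"
  shows "bounded_below (poly_operator H [:a\<^sup>2 + b\<^sup>2, - 2 * a, 1:] T)"
proof -
  note TB = self_adjointD(1)[OF T]
  let ?Q = "poly_operator H [:- a, 1:] T"
  have split: "[:a\<^sup>2 + b\<^sup>2, - 2 * a, 1:] = [:- a, 1:] * [:- a, 1:] + [:b\<^sup>2:]"
    by (simp add: power2_eq_square)
  have "b\<^sup>2 * \<parallel>f\<parallel> \<le> \<parallel>poly_operator H [:a\<^sup>2 + b\<^sup>2, - 2 * a, 1:] T f\<parallel>" if f: "f \<in> vecs H" for f
  proof (rule norm_ge_if_coercive[OF f])
    have "\<langle>?Q (?Q f), f\<rangle> = \<langle>?Q f, ?Q f\<rangle>"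
      using self_adjointD(2)[OF poly_operator_self_adjoint[OF T]] f TB by simp
    then have "Re \<langle>poly_operator H [:a\<^sup>2 + b\<^sup>2, - 2 * a, 1:] T f, f\<rangle> = \<parallel>?Q f\<parallel>\<^sup>2 + b\<^sup>2 * \<parallel>f\<parallel>\<^sup>2"
      unfolding split poly_operator_add[OF TB f] poly_operator_mult[OF TB f] poly_operator_const[OF TB f]
      using f TB by (simp add: iprod_linear iprod_self flip: of_real_power of_real_mult)
    then show "b\<^sup>2 * \<parallel>f\<parallel>\<^sup>2 \<le> Re \<langle>poly_operator H [:a\<^sup>2 + b\<^sup>2, - 2 * a, 1:] T f, f\<rangle>"
      by simp
  qed (simp add: TB)
  then show ?thesis
    unfolding bounded_below_def using b by (intro exI[of _ "b\<^sup>2"]) simp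
qed

text \<open>
  Induction on the degree: a complex root of \<open>q\<close> splits off a real linear factor, if the root is
  real, and a real quadratic factor otherwise.  This treats real scalars without complexifying the
  space.
\<close>

lemma poly_bounded_below:
  assumes T: "self_adjoint T" and "q \<noteq> 0" and "\<And>t. t \<in> real_spectrum T \<Longrightarrow> poly q t \<noteq> 0"
  shows "bounded_below (poly_operator H q T)"
  using assms(2,3)
proof (induction "degree q" arbitrary: q rule: less_induct)
  case less
  note TB = self_adjointD(1)[OF T]
  show ?case
  proof (cases "degree q = 0")
    case True
    then obtain a where q: "q = [:a:]" by (rule degree_eq_zeroE)
    with less.prems have "a \<noteq> 0" by simp
    moreover have "\<bar>a\<bar> * \<parallel>f\<parallel> \<le> \<parallel>poly_operator H q T f\<parallel>" if "f \<in> vecs H" for f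
      using vnorm_scale[OF of_real_scalar that] by (simp add: q poly_operator_const[OF TB that])
    ultimately show ?thesis
      unfolding bounded_below_def by (intro exI[of _ "\<bar>a\<bar>"]) simp
  next
    case False
    then obtain z where z: "complex_value q z = 0"
      using complex_root_exists by auto
    have step: "bounded_below (poly_operator H q T)"
      if "d dvd q" "degree d > 0" "bounded_below (poly_operator H d T)" for d
    proof -
      obtain s where s: "q = d * s" using \<open>d dvd q\<close> by (rule dvdE)
      with less.prems have ds: "d \<noteq> 0" "s \<noteq> 0" by auto
      then have "degree s < degree q"
        using s that(2) by (simp add: degree_mult_eq)
      moreover have "poly s t \<noteq> 0" if "t \<in> real_spectrum T" for t
        using less.prems(2)[OF that] s by simp
      ultimately have "bounded_below (poly_operator H s T)"
        using less.hyps ds by blast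
      then show ?thesis
        unfolding s by (rule bounded_below_poly_mult[OF TB that(3)])
    qed
    show ?thesis
    proof (cases "Im z = 0")
      case True
      then have "z = complex_of_real (Re z)" by (simp add: complex_eq_iff)
      then have root: "poly q (Re z) = 0"
        using z complex_value_of_real[of q "Re z"] by simp
      then have "Re z \<notin> real_spectrum T" using less.prems(2) by blast
      from step[OF _ _ bounded_below_linear[OF T this]] root show ?thesis
        by (simp add: poly_eq_0_iff_dvd)
    next
      case False
      show ?thesis
        by (rule step[OF quadratic_factor[OF z False] _ bounded_below_quadratic[OF T False]]) simp
    qed
  qed
qed

text \<open>
  With \<open>M = \<parallel>Q\<parallel>\<close>, expanding the square gives
  \<open>\<parallel>(Q\<^sup>2 - M\<^sup>2) f\<parallel>\<^sup>2 = \<parallel>Q\<^sup>2 f\<parallel>\<^sup>2 - 2 M\<^sup>2 \<parallel>Q f\<parallel>\<^sup>2 + M\<^sup>4 \<parallel>f\<parallel>\<^sup>2 \<le> M\<^sup>4 \<parallel>f\<parallel>\<^sup>2 - M\<^sup>2 \<parallel>Q f\<parallel>\<^sup>2\<close>.  A lower bound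
  \<open>d\<^sup>2 \<parallel>f\<parallel>\<^sup>2\<close> of the left side would therefore give \<open>Q\<close> a norm smaller than \<open>M\<close>.
\<close>

lemma operator_norm_approximately_attained:
  assumes Q: "self_adjoint Q" and f0: "f0 \<in> vecs H" "f0 \<noteq> 0" and d: "d > 0"
  shows "\<exists>f\<in>vecs H. \<parallel>Q (Q f) - fscale (complex_of_real ((operator_norm H Q)\<^sup>2)) f\<parallel> < d * \<parallel>f\<parallel>"
proof (rule ccontr)
  assume contra: "\<not> ?thesis"
  note QB = self_adjointD(1)[OF Q]
  define M where "M = operator_norm H Q"
  have M: "M \<ge> 0" using QB by (simp add: M_def)
  have key: "M\<^sup>2 * \<parallel>Q f\<parallel>\<^sup>2 \<le> (M ^ 4 - d\<^sup>2) * \<parallel>f\<parallel>\<^sup>2" if f: "f \<in> vecs H" for f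
  proof -
    let ?g = "Q (Q f) - fscale (complex_of_real (M\<^sup>2)) f"
    have Qf: "Q f \<in> vecs H" "Q (Q f) \<in> vecs H" using QB by (simp_all add: bo_mem)
    have g: "?g \<in> vecs H" using Qf f by (intro diff_mem scale_mem of_real_scalar)
    have "d * \<parallel>f\<parallel> \<le> \<parallel>?g\<parallel>"
      using contra f unfolding M_def by force
    then have "(d * \<parallel>f\<parallel>)\<^sup>2 \<le> \<parallel>?g\<parallel>\<^sup>2"
      by (rule power_mono) (use d f in simp)
    then have "d\<^sup>2 * \<parallel>f\<parallel>\<^sup>2 \<le> \<parallel>?g\<parallel>\<^sup>2"
      by (simp only: power_mult_distrib)
    also have "\<parallel>?g\<parallel>\<^sup>2 = \<parallel>Q (Q f)\<parallel>\<^sup>2 - 2 * M\<^sup>2 * \<parallel>Q f\<parallel>\<^sup>2 + M ^ 4 * \<parallel>f\<parallel>\<^sup>2"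
    proof -
      have 1: "Re \<langle>Q (Q f), f\<rangle> = \<parallel>Q f\<parallel>\<^sup>2"
        using self_adjointD(2)[OF Q Qf(1) f] Qf by (simp add: vnorm_squared)
      then have 2: "Re \<langle>f, Q (Q f)\<rangle> = \<parallel>Q f\<parallel>\<^sup>2"
        using iprod_cnj[OF Qf(2) f] by simp
      show ?thesis
        unfolding vnorm_squared[OF g] using Qf f 1 2 vnorm_squared[OF f] vnorm_squared[OF Qf(2)]
        by (simp add: iprod_linear algebra_simps power4_eq_xxxx flip: of_real_power)
    qed
    also have "\<parallel>Q (Q f)\<parallel>\<^sup>2 \<le> (M * \<parallel>Q f\<parallel>)\<^sup>2"
      using operator_norm_bound[OF QB Qf(1)] Qf by (intro power_mono) (simp_all add: M_def)
    finally show ?thesis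
      by (simp add: power_mult_distrib algebra_simps)
  qed
  have "M ^ 4 - d\<^sup>2 \<ge> 0"
  proof -
    have "0 \<le> M\<^sup>2 * \<parallel>Q f0\<parallel>\<^sup>2" by simp
    then have "0 \<le> (M ^ 4 - d\<^sup>2) * \<parallel>f0\<parallel>\<^sup>2" using key[OF f0(1)] by linarith
    then show ?thesis
      using f0 vnorm_eq_zero[OF f0(1)] by (simp add: zero_le_mult_iff)
  qed
  then have "M > 0" using d M by (cases "M = 0") auto
  define c where "c = sqrt ((M ^ 4 - d\<^sup>2) / M\<^sup>2)"
  have "\<parallel>Q f\<parallel> \<le> c * \<parallel>f\<parallel>" if f: "f \<in> vecs H" for f
  proof -
    have "\<parallel>Q f\<parallel>\<^sup>2 \<le> (M ^ 4 - d\<^sup>2) / M\<^sup>2 * \<parallel>f\<parallel>\<^sup>2"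
      using key[OF f] \<open>M > 0\<close> by (simp add: field_simps)
    also have "\<dots> = (c * \<parallel>f\<parallel>)\<^sup>2"
      using \<open>M ^ 4 - d\<^sup>2 \<ge> 0\<close> by (simp add: c_def power_mult_distrib)
    finally show ?thesis
      by (rule power2_le_imp_le) (use f \<open>M ^ 4 - d\<^sup>2 \<ge> 0\<close> in \<open>intro mult_nonneg_nonneg; simp add: c_def\<close>)
  qed
  then have "M \<le> c"
    unfolding M_def
    by (rule operator_norm_le) (use \<open>M ^ 4 - d\<^sup>2 \<ge> 0\<close> in \<open>simp_all add: c_def\<close>)
  then have "M\<^sup>2 \<le> (M ^ 4 - d\<^sup>2) / M\<^sup>2"
    using \<open>M > 0\<close> power_mono[of M c 2] \<open>M ^ 4 - d\<^sup>2 \<ge> 0\<close> by (simp add: c_def)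
  then have "d * d \<le> 0"
    using \<open>M > 0\<close> by (simp add: field_simps power4_eq_xxxx power2_eq_square)
  then show False
    using mult_pos_pos[OF d d] by linarith
qed

lemma operator_norm_not_bounded_below:
  assumes T: "self_adjoint T" and f0: "f0 \<in> vecs H" "f0 \<noteq> 0"
  shows "\<not> bounded_below (poly_operator H (p * p - [:(operator_norm H (poly_operator H p T))\<^sup>2:]) T)"
proof
  note TB = self_adjointD(1)[OF T]
  let ?Q = "poly_operator H p T"
  let ?M = "operator_norm H ?Q"
  assume "bounded_below (poly_operator H (p * p - [:?M\<^sup>2:]) T)"
  then obtain d where d: "d > 0"
    "\<And>f. f \<in> vecs H \<Longrightarrow> d * \<parallel>f\<parallel> \<le> \<parallel>poly_operator H (p * p - [:?M\<^sup>2:]) T f\<parallel>"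
    unfolding bounded_below_def by blast
  obtain f where f: "f \<in> vecs H" "\<parallel>?Q (?Q f) - fscale (complex_of_real (?M\<^sup>2)) f\<parallel> < d * \<parallel>f\<parallel>"
    using operator_norm_approximately_attained[OF poly_operator_self_adjoint[OF T] f0 d(1)] by blast
  with d(2)[OF f(1)] show False
    by (simp add: poly_operator_diff[OF TB f(1)] poly_operator_mult[OF TB f(1)]
        poly_operator_const[OF TB f(1)] del: of_real_power)
qed

text \<open>
  Otherwise \<open>t\<^sup>2 - \<parallel>T\<parallel>\<^sup>2\<close> has no root in the spectrum, and \<open>T\<^sup>2 - \<parallel>T\<parallel>\<^sup>2\<close> is bounded below,
  although unit vectors come arbitrarily close to attaining the norm of \<open>T\<close>.
\<close>

lemma real_spectrum_nonempty:
  assumes T: "self_adjoint T" and f0: "f0 \<in> vecs H" "f0 \<noteq> 0"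
  shows "real_spectrum T \<noteq> {}"
proof
  let ?q = "[:0, 1:] * [:0, 1:] - [:(operator_norm H (poly_operator H [:0, 1:] T))\<^sup>2:]"
  assume "real_spectrum T = {}"
  moreover have "?q \<noteq> 0" by simp
  ultimately have "bounded_below (poly_operator H ?q T)"
    by (intro poly_bounded_below[OF T]) simp_all
  with operator_norm_not_bounded_below[OF T f0] show False by blast
qed

text \<open>
  If \<open>\<parallel>p(T)\<parallel>\<close> exceeded every value of \<open>\<bar>p\<bar>\<close> on the spectrum, then \<open>p\<^sup>2 - \<parallel>p(T)\<parallel>\<^sup>2\<close> would have no root
  there and its value at \<open>T\<close> would be bounded below.  That this polynomial is nonzero needs the
  spectrum to be nonempty, which is why the zero space is treated separately.
\<close>

lemma operator_norm_poly_le: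
  assumes T: "self_adjoint T" and c: "c \<ge> 0"
    and bound: "\<And>t. t \<in> real_spectrum T \<Longrightarrow> \<bar>poly p t\<bar> \<le> c"
  shows "operator_norm H (poly_operator H p T) \<le> c"
proof (cases "vecs H \<subseteq> {0}")
  case True
  then show ?thesis
    using c bo_zero[OF poly_operator_bo[OF self_adjointD(1)[OF T]]]
    by (intro operator_norm_le) auto
next
  case False
  then obtain f0 where f0: "f0 \<in> vecs H" "f0 \<noteq> 0" by blast
  let ?M = "operator_norm H (poly_operator H p T)"
  show ?thesis
  proof (rule ccontr)
    assume "\<not> ?thesis"
    then have less: "c < ?M" by simp
    let ?q = "p * p - [:?M\<^sup>2:]"
    have nz: "poly ?q t \<noteq> 0" if "t \<in> real_spectrum T" for t
    proof -
      have "\<bar>poly p t\<bar>\<^sup>2 < ?M\<^sup>2"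
        using bound[OF that] less by (intro power_strict_mono) auto
      then show ?thesis by (simp add: power2_eq_square)
    qed
    moreover from nz real_spectrum_nonempty[OF T f0] have "?q \<noteq> 0" by force
    ultimately show False
      using poly_bounded_below[OF T] operator_norm_not_bounded_below[OF T f0] by blast
  qed
qed

section \<open>Continuous functional calculus\<close>

lemma polynomial_approximation:
  fixes X :: "real set"
  assumes "compact X" "continuous_on X \<phi>"
  shows "\<exists>p :: nat \<Rightarrow> real poly. uniform_limit X (\<lambda>n. poly (p n)) \<phi> sequentially"
proof -
  have "\<exists>p. \<forall>t\<in>X. \<bar>\<phi> t - poly p t\<bar> < 1 / real (Suc n)" for n
  proof -
    obtain g where g: "real_polynomial_function g" "\<And>t. t \<in> X \<Longrightarrow> \<bar>\<phi> t - g t\<bar> < 1 / real (Suc n)"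
      using Stone_Weierstrass_real_polynomial_function[OF assms, of "1 / real (Suc n)"] by auto
    obtain a m where "g = (\<lambda>t. \<Sum>i\<le>m. a i * t ^ i)"
      using g(1) unfolding real_polynomial_function_iff_sum by blast
    then have "poly (\<Sum>i\<le>m. monom (a i) i) t = g t" for t
      by (simp add: poly_sum poly_monom)
    then show ?thesis
      using g(2) by metis
  qed
  then obtain p where p: "\<And>n t. t \<in> X \<Longrightarrow> \<bar>\<phi> t - poly (p n) t\<bar> < 1 / real (Suc n)"
    by metis
  have "uniform_limit X (\<lambda>n. poly (p n)) \<phi> sequentially"
  proof (rule uniform_limitI)
    fix e :: real assume "e > 0"
    then obtain N where N: "1 / real (Suc N) < e"
      using reals_Archimedean[of e] by (auto simp: inverse_eq_divide)
    have "dist (poly (p n) t) (\<phi> t) < e" if "n \<ge> N" "t \<in> X" for n t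
    proof -
      have "1 / real (Suc n) \<le> 1 / real (Suc N)"
        using that by (intro divide_left_mono) auto
      then show ?thesis
        using p[OF that(2), of n] N by (simp add: dist_real_def abs_minus_commute)
    qed
    then show "\<forall>\<^sub>F n in sequentially. \<forall>t\<in>X. dist (poly (p n) t) (\<phi> t) < e"
      unfolding eventually_sequentially by blast
  qed
  then show ?thesis by blast
qed

lemma operator_norm_triangle:
  assumes "R \<in> bounded_operators H" "S \<in> bounded_operators H" "T \<in> bounded_operators H"
  shows "operator_norm H (R - T) \<le> operator_norm H (R - S) + operator_norm H (S - T)"
proof (rule operator_norm_le)
  fix f assume f: "f \<in> vecs H"
  have "\<parallel>R f - T f\<parallel> \<le> \<parallel>R f - S f\<parallel> + \<parallel>S f - T f\<parallel>"
    by (rule vnorm_triangle_diff) (simp_all add: assms[THEN bo_mem])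
  also have "\<dots> \<le> operator_norm H (R - S) * \<parallel>f\<parallel> + operator_norm H (S - T) * \<parallel>f\<parallel>"
    using operator_norm_bound[OF bo_difference f] assms by (intro add_mono) (simp_all add: fun_apply)
  finally show "\<parallel>(R - T) f\<parallel> \<le> (operator_norm H (R - S) + operator_norm H (S - T)) * \<parallel>f\<parallel>"
    by (simp add: distrib_right fun_apply)
qed (simp add: bo_difference assms)

lemma operator_norm_minus_commute:
  assumes "S \<in> bounded_operators H" "T \<in> bounded_operators H"
  shows "operator_norm H (S - T) = operator_norm H (T - S)"
  unfolding operator_norm_def
  by (rule SUP_cong) (simp_all add: fun_apply vnorm_minus_commute assms[THEN bo_mem])

lemma poly_operators_uniform:
  assumes T: "self_adjoint T"
    and p: "uniform_limit (real_spectrum T) (\<lambda>n. poly (p n)) \<phi> sequentially"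
    and q: "uniform_limit (real_spectrum T) (\<lambda>n. poly (q n)) \<phi> sequentially"
    and e: "e > 0"
  shows "\<exists>N. \<forall>m\<ge>N. \<forall>n\<ge>N. operator_norm H (poly_operator H (p m) T - poly_operator H (q n) T) < e"
proof -
  note TB = self_adjointD(1)[OF T]
  have e4: "e / 4 > 0" using e by simp
  obtain N where N: "\<And>n t. n \<ge> N \<Longrightarrow> t \<in> real_spectrum T \<Longrightarrow> dist (poly (p n) t) (\<phi> t) < e / 4"
    using uniform_limitD[OF p e4] unfolding eventually_sequentially by blast
  obtain N' where N': "\<And>n t. n \<ge> N' \<Longrightarrow> t \<in> real_spectrum T \<Longrightarrow> dist (poly (q n) t) (\<phi> t) < e / 4"
    using uniform_limitD[OF q e4] unfolding eventually_sequentially by blast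
  have "operator_norm H (poly_operator H (p m) T - poly_operator H (q n) T) < e"
    if mn: "m \<ge> max N N'" "n \<ge> max N N'" for m n
  proof -
    have "poly_operator H (p m) T - poly_operator H (q n) T = poly_operator H (p m - q n) T"
    proof
      fix f show "(poly_operator H (p m) T - poly_operator H (q n) T) f = poly_operator H (p m - q n) T f"
        by (cases "f \<in> vecs H") (simp_all add: fun_apply(3) poly_operator_diff[OF TB])
    qed
    moreover have "operator_norm H (poly_operator H (p m - q n) T) \<le> e / 2"
    proof (rule operator_norm_poly_le[OF T])
      fix t assume t: "t \<in> real_spectrum T"
      show "\<bar>poly (p m - q n) t\<bar> \<le> e / 2"
      proof -
        have "\<bar>poly (p m) t - \<phi> t\<bar> < e / 4" "\<bar>poly (q n) t - \<phi> t\<bar> < e / 4"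
          using N[OF _ t, of m] N'[OF _ t, of n] mn by (simp_all add: dist_real_def)
        then show ?thesis
          unfolding poly_diff by linarith
      qed
    qed (use e in simp)
    ultimately show ?thesis using e by simp
  qed
  then show ?thesis by blast
qed

text \<open>
  The functional calculus is a definite description, so both existence and uniqueness of the limit
  operator are due.  The function \<open>\<phi>\<close> is taken continuous on a compact superset \<open>X\<close> of the spectrum,
  since Weierstrass approximation takes place on \<open>X\<close>; the polynomial sequences that the definition
  quantifies over converge on the spectrum only, where \<open>operator_norm_poly_le\<close> controls them.
\<close>

lemma functional_calculus_limit:
  assumes T: "self_adjoint T" and X: "compact X" "real_spectrum T \<subseteq> X" and \<phi>: "continuous_on X \<phi>"
  shows "functional_calculus H \<phi> T \<in> bounded_operators H"
    and "uniform_limit (real_spectrum T) (\<lambda>n. poly (p n)) \<phi> sequentially \<Longrightarrow>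
      (\<lambda>n. operator_norm H (poly_operator H (p n) T - functional_calculus H \<phi> T)) \<longlonglongrightarrow> 0"
proof -
  note PB = poly_operator_bo[OF self_adjointD(1)[OF T]]
  let ?P = "\<lambda>S. S \<in> bounded_operators H \<and>
     (\<forall>p. uniform_limit (real_spectrum T) (\<lambda>n. poly (p n)) \<phi> sequentially \<longrightarrow>
        (\<lambda>n. operator_norm H (poly_operator H (p n) T - S)) \<longlonglongrightarrow> 0)"
  obtain q :: "nat \<Rightarrow> real poly" where "uniform_limit X (\<lambda>n. poly (q n)) \<phi> sequentially"
    using polynomial_approximation[OF X(1) \<phi>] by blast
  then have q: "uniform_limit (real_spectrum T) (\<lambda>n. poly (q n)) \<phi> sequentially"
    by (rule uniform_limit_on_subset[OF _ X(2)])
  obtain S where S: "S \<in> bounded_operators H"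
    "(\<lambda>n. operator_norm H (poly_operator H (q n) T - S)) \<longlonglongrightarrow> 0"
    using bo_complete[OF PB poly_operators_uniform[OF T q q]] by blast
  have "?P S"
  proof (intro conjI allI impI)
    fix p assume p: "uniform_limit (real_spectrum T) (\<lambda>n. poly (p n)) \<phi> sequentially"
    let ?D = "\<lambda>n. operator_norm H (poly_operator H (p n) T - poly_operator H (q n) T)"
    have "?D \<longlonglongrightarrow> 0"
    proof (rule LIMSEQ_I)
      fix e :: real assume "e > 0"
      from poly_operators_uniform[OF T p q this] show "\<exists>N. \<forall>n\<ge>N. norm (?D n - 0) < e"
        using bo_difference[OF PB PB] by simp blast
    qed
    from tendsto_add[OF this S(2)]
    have "(\<lambda>n. ?D n + operator_norm H (poly_operator H (q n) T - S)) \<longlonglongrightarrow> 0" by simp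
    moreover have "norm (operator_norm H (poly_operator H (p n) T - S)) \<le>
        ?D n + operator_norm H (poly_operator H (q n) T - S)" for n
      using operator_norm_triangle[OF PB PB S(1), of "p n" "q n"] bo_difference[OF PB S(1), of "p n"]
      by simp
    ultimately show "(\<lambda>n. operator_norm H (poly_operator H (p n) T - S)) \<longlonglongrightarrow> 0"
      by (rule null_sequence_if_bounded)
  qed (rule S(1))
  moreover have "R = S" if R: "?P R" for R
  proof -
    have "(\<lambda>n. operator_norm H (poly_operator H (q n) T - R)) \<longlonglongrightarrow> 0"
      using R q by blast
    from tendsto_add[OF this S(2)]
    have "(\<lambda>n. operator_norm H (poly_operator H (q n) T - R) +
        operator_norm H (poly_operator H (q n) T - S)) \<longlonglongrightarrow> 0" by simp
    then have "operator_norm H (R - S) \<le> 0"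
      using operator_norm_triangle[OF _ PB S(1), of R] operator_norm_minus_commute[OF PB, of R] R
      by (intro LIMSEQ_le_const[of _ 0]) auto
    then have "\<parallel>R f - S f\<parallel> = 0" if f: "f \<in> vecs H" for f
      using operator_norm_bound[OF bo_difference[OF _ S(1)] f, of R] R f bo_mem[OF S(1)] bo_mem[of R]
        mult_right_mono[of "operator_norm H (R - S)" 0 "\<parallel>f\<parallel>"]
      by (intro antisym) (simp_all add: fun_apply)
    then have "R f = S f" if f: "f \<in> vecs H" for f
      using vnorm_eq_zero[of "R f - S f"] R S(1) f by (simp add: bo_mem)
    then show "R = S"
      using R S(1) by (intro ext[of R S]) (metis bo_outside)
  qed
  ultimately have "\<exists>!S. ?P S" by blast
  then have P: "?P (functional_calculus H \<phi> T)"
    unfolding functional_calculus_def by (rule theI')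
  then show "functional_calculus H \<phi> T \<in> bounded_operators H"
    and "uniform_limit (real_spectrum T) (\<lambda>n. poly (p n)) \<phi> sequentially \<Longrightarrow>
      (\<lambda>n. operator_norm H (poly_operator H (p n) T - functional_calculus H \<phi> T)) \<longlonglongrightarrow> 0"
    by blast+
qed

lemma functional_calculus_vlim:
  assumes T: "self_adjoint T" and X: "compact X" "real_spectrum T \<subseteq> X" and \<phi>: "continuous_on X \<phi>"
    and p: "uniform_limit X (\<lambda>n. poly (p n)) \<phi> sequentially" and f: "f \<in> vecs H"
  shows "vlim (\<lambda>n. poly_operator H (p n) T f) (functional_calculus H \<phi> T f)"
proof -
  let ?S = "functional_calculus H \<phi> T"
  note PB = poly_operator_bo[OF self_adjointD(1)[OF T]]
  note S = functional_calculus_limit[OF T X \<phi>]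
  have "(\<lambda>n. operator_norm H (poly_operator H (p n) T - ?S) * \<parallel>f\<parallel>) \<longlonglongrightarrow> 0"
    by (rule tendsto_mult_left_zero[OF S(2)[OF uniform_limit_on_subset[OF p X(2)]]])
  moreover have "norm \<parallel>poly_operator H (p n) T f - ?S f\<parallel> \<le>
      operator_norm H (poly_operator H (p n) T - ?S) * \<parallel>f\<parallel>" for n
    using operator_norm_bound[OF bo_difference[OF PB S(1)] f, of "p n"] bo_mem[OF PB] bo_mem[OF S(1)]
    by (simp add: fun_apply)
  ultimately have "(\<lambda>n. \<parallel>poly_operator H (p n) T f - ?S f\<parallel>) \<longlonglongrightarrow> 0"
    by (rule null_sequence_if_bounded)
  then show ?thesis
    by (simp add: vlim_def bo_mem[OF PB] bo_mem[OF S(1)])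
qed

text \<open>
  A common compact set \<open>X\<close> lets the same polynomials approximate \<open>\<phi>\<close> on both spectra.
\<close>

lemma functional_calculus_intertwine:
  assumes A: "A \<in> bounded_operators H" and S: "self_adjoint S" and T: "self_adjoint T"
    and comm: "\<And>f. f \<in> vecs H \<Longrightarrow> T (A f) = A (S f)"
    and X: "compact X" "real_spectrum S \<subseteq> X" "real_spectrum T \<subseteq> X"
    and \<phi>: "continuous_on X \<phi>" and f: "f \<in> vecs H"
  shows "functional_calculus H \<phi> T (A f) = A (functional_calculus H \<phi> S f)"
proof -
  obtain p :: "nat \<Rightarrow> real poly" where p: "uniform_limit X (\<lambda>n. poly (p n)) \<phi> sequentially"
    using polynomial_approximation[OF X(1) \<phi>] by blast
  have "vlim (\<lambda>n. poly_operator H (p n) T (A f)) (functional_calculus H \<phi> T (A f))"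
    by (rule functional_calculus_vlim[OF T X(1,3) \<phi> p bo_mem[OF A]])
  moreover have "vlim (\<lambda>n. A (poly_operator H (p n) S f)) (A (functional_calculus H \<phi> S f))"
    by (rule bo_vlim[OF A functional_calculus_vlim[OF S X(1,2) \<phi> p f]])
  moreover have "poly_operator H (p n) T (A f) = A (poly_operator H (p n) S f)" for n
    by (rule poly_operator_intertwine[OF A self_adjointD(1)[OF S] self_adjointD(1)[OF T]])
      (simp_all add: comm f)
  ultimately show ?thesis
    by (simp only: vlim_unique)
qed

context
  fixes T :: "'w operator" and X :: "real set"
  assumes T: "self_adjoint T" and X: "compact X" "real_spectrum T \<subseteq> X"
begin

abbreviation calc where "calc \<phi> \<equiv> functional_calculus H \<phi> T"

private lemmas TB = self_adjointD(1)[OF T]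
private lemmas calc_vlim = functional_calculus_vlim[OF T X]

lemma calc_mem: "continuous_on X \<phi> \<Longrightarrow> calc \<phi> f \<in> vecs H"
  by (rule bo_mem[OF functional_calculus_limit(1)[OF T X]])

lemma calc_self_adjoint:
  assumes \<phi>: "continuous_on X \<phi>"
  shows "self_adjoint (calc \<phi>)"
proof -
  obtain p :: "nat \<Rightarrow> real poly" where p: "uniform_limit X (\<lambda>n. poly (p n)) \<phi> sequentially"
    using polynomial_approximation[OF X(1) \<phi>] by blast
  have "\<langle>calc \<phi> f, g\<rangle> = \<langle>f, calc \<phi> g\<rangle>" if fg: "f \<in> vecs H" "g \<in> vecs H" for f g
  proof (rule LIMSEQ_unique)
    show "(\<lambda>n. \<langle>poly_operator H (p n) T f, g\<rangle>) \<longlonglongrightarrow> \<langle>calc \<phi> f, g\<rangle>"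
      by (rule vlim_iprod(1)[OF calc_vlim[OF \<phi> p fg(1)] fg(2)])
    have "\<langle>poly_operator H (p n) T f, g\<rangle> = \<langle>f, poly_operator H (p n) T g\<rangle>" for n
      by (rule self_adjointD(2)[OF poly_operator_self_adjoint[OF T] fg])
    then show "(\<lambda>n. \<langle>poly_operator H (p n) T f, g\<rangle>) \<longlonglongrightarrow> \<langle>f, calc \<phi> g\<rangle>"
      using vlim_iprod(2)[OF calc_vlim[OF \<phi> p fg(2)] fg(1)] by simp
  qed
  then show ?thesis
    by (simp add: self_adjoint_def functional_calculus_limit(1)[OF T X \<phi>])
qed

text \<open>
  The equation passes to the limit weakly: \<open>\<langle>h, p(T) q(T) f\<rangle> = \<langle>p(T) h, q(T) f\<rangle>\<close>, and each side of
  the last inner product converges in norm.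
\<close>

lemma calc_mult:
  assumes \<phi>: "continuous_on X \<phi>" and \<psi>: "continuous_on X \<psi>" and f: "f \<in> vecs H"
  shows "calc (\<lambda>t. \<phi> t * \<psi> t) f = calc \<phi> (calc \<psi> f)"
proof -
  obtain p :: "nat \<Rightarrow> real poly" where p: "uniform_limit X (\<lambda>n. poly (p n)) \<phi> sequentially"
    using polynomial_approximation[OF X(1) \<phi>] by blast
  obtain q :: "nat \<Rightarrow> real poly" where q: "uniform_limit X (\<lambda>n. poly (q n)) \<psi> sequentially"
    using polynomial_approximation[OF X(1) \<psi>] by blast
  have bounded: "bounded (\<phi> ` X)" "bounded (\<psi> ` X)"
    using X(1) \<phi> \<psi> by (simp_all add: compact_continuous_image compact_imp_bounded)
  have pq: "uniform_limit X (\<lambda>n. poly (p n * q n)) (\<lambda>t. \<phi> t * \<psi> t) sequentially"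
    using uniform_lim_mult[OF p q bounded] by (simp only: poly_mult[abs_def])
  have cont: "continuous_on X (\<lambda>t. \<phi> t * \<psi> t)"
    using \<phi> \<psi> by (rule continuous_on_mult)
  show ?thesis
  proof (rule eq_if_iprod_eq)
    fix h assume h: "h \<in> vecs H"
    have "\<langle>h, calc (\<lambda>t. \<phi> t * \<psi> t) f\<rangle> = \<langle>calc \<phi> h, calc \<psi> f\<rangle>"
    proof (rule LIMSEQ_unique)
      show "(\<lambda>n. \<langle>h, poly_operator H (p n * q n) T f\<rangle>) \<longlonglongrightarrow> \<langle>h, calc (\<lambda>t. \<phi> t * \<psi> t) f\<rangle>"
        by (rule vlim_iprod(2)[OF calc_vlim[OF cont pq f] h])
      have "\<langle>h, poly_operator H (p n * q n) T f\<rangle> = \<langle>poly_operator H (p n) T h, poly_operator H (q n) T f\<rangle>" for n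
        using self_adjointD(2)[OF poly_operator_self_adjoint[OF T] h]
        by (simp add: poly_operator_mult[OF TB f] TB)
      then show "(\<lambda>n. \<langle>h, poly_operator H (p n * q n) T f\<rangle>) \<longlonglongrightarrow> \<langle>calc \<phi> h, calc \<psi> f\<rangle>"
        using vlim_iprod_both[OF calc_vlim[OF \<phi> p h] calc_vlim[OF \<psi> q f]] by simp
    qed
    also have "\<dots> = \<langle>h, calc \<phi> (calc \<psi> f)\<rangle>"
      by (rule self_adjointD(2)[OF calc_self_adjoint[OF \<phi>] h calc_mem[OF \<psi>]])
    finally show "\<langle>h, calc (\<lambda>t. \<phi> t * \<psi> t) f\<rangle> = \<langle>h, calc \<phi> (calc \<psi> f)\<rangle>" .
  qed (simp_all add: calc_mem cont \<phi> \<psi>)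
qed

lemma calc_diff:
  assumes \<phi>: "continuous_on X \<phi>" and \<psi>: "continuous_on X \<psi>" and f: "f \<in> vecs H"
  shows "calc (\<lambda>t. \<phi> t - \<psi> t) f = calc \<phi> f - calc \<psi> f"
proof -
  obtain p :: "nat \<Rightarrow> real poly" where p: "uniform_limit X (\<lambda>n. poly (p n)) \<phi> sequentially"
    using polynomial_approximation[OF X(1) \<phi>] by blast
  obtain q :: "nat \<Rightarrow> real poly" where q: "uniform_limit X (\<lambda>n. poly (q n)) \<psi> sequentially"
    using polynomial_approximation[OF X(1) \<psi>] by blast
  have pq: "uniform_limit X (\<lambda>n. poly (p n - q n)) (\<lambda>t. \<phi> t - \<psi> t) sequentially"
    using uniform_limit_minus[OF p q] by (simp only: poly_diff[abs_def])
  have cont: "continuous_on X (\<lambda>t. \<phi> t - \<psi> t)"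
    using \<phi> \<psi> by (rule continuous_on_diff)
  show ?thesis
    using calc_vlim[OF cont pq f] vlim_diff[OF calc_vlim[OF \<phi> p f] calc_vlim[OF \<psi> q f]]
    unfolding poly_operator_diff[OF TB f] by (rule vlim_unique)
qed

lemma calc_poly:
  assumes eq: "\<And>t. t \<in> X \<Longrightarrow> \<phi> t = poly p t" and f: "f \<in> vecs H"
  shows "calc \<phi> f = poly_operator H p T f"
proof -
  have \<phi>: "continuous_on X \<phi>"
    using eq by (subst continuous_on_cong[OF refl eq]) (auto intro: continuous_intros)
  have "uniform_limit X (\<lambda>n. poly p) \<phi> sequentially"
    using eq by (intro uniform_limitI) simp
  from calc_vlim[OF \<phi> this f] show ?thesis
    by (rule vlim_unique) (simp add: TB)
qed

text \<open>
  A nonnegative \<open>\<phi>\<close> is the square of \<open>sqrt \<phi>\<close>, so \<open>\<phi>(T)\<close> is the square of a self-adjoint operator.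
\<close>

lemma calc_nonneg:
  assumes \<phi>: "continuous_on X \<phi>" and nonneg: "\<And>t. t \<in> X \<Longrightarrow> 0 \<le> \<phi> t" and f: "f \<in> vecs H"
  shows "0 \<le> Re \<langle>calc \<phi> f, f\<rangle>"
proof -
  let ?r = "\<lambda>t. sqrt (\<phi> t)"
  have r: "continuous_on X ?r"
    using \<phi> by (rule continuous_on_real_sqrt)
  obtain p :: "nat \<Rightarrow> real poly" where p: "uniform_limit X (\<lambda>n. poly (p n)) \<phi> sequentially"
    using polynomial_approximation[OF X(1) \<phi>] by blast
  have rr: "continuous_on X (\<lambda>t. ?r t * ?r t)"
    using r r by (rule continuous_on_mult)
  have "uniform_limit X (\<lambda>n. poly (p n)) (\<lambda>t. ?r t * ?r t) sequentially"
    using p nonneg by (subst uniform_limit_cong'[of X _ "\<lambda>n. poly (p n)" _ \<phi>]) simp_all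
  from vlim_unique[OF calc_vlim[OF \<phi> p f] calc_vlim[OF rr this f]]
  have "calc \<phi> f = calc ?r (calc ?r f)"
    by (simp only: calc_mult[OF r r f])
  then have "Re \<langle>calc \<phi> f, f\<rangle> = Re \<langle>calc ?r f, calc ?r f\<rangle>"
    using self_adjointD(2)[OF calc_self_adjoint[OF r] calc_mem[OF r] f] by simp
  then show ?thesis
    using iprod_nonneg[OF calc_mem[OF r]] by simp
qed

lemma calc_mono:
  assumes \<phi>: "continuous_on X \<phi>" and \<psi>: "continuous_on X \<psi>"
    and le: "\<And>t. t \<in> X \<Longrightarrow> \<phi> t \<le> \<psi> t" and f: "f \<in> vecs H"
  shows "Re \<langle>calc \<phi> f, f\<rangle> \<le> Re \<langle>calc \<psi> f, f\<rangle>"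
proof -
  have "0 \<le> Re \<langle>calc (\<lambda>t. \<psi> t - \<phi> t) f, f\<rangle>"
    using le by (intro calc_nonneg continuous_on_diff \<phi> \<psi> f) simp
  then show ?thesis
    using f by (simp add: calc_diff \<phi> \<psi> iprod_linear calc_mem)
qed

lemma calc_norm_squared:
  assumes \<phi>: "continuous_on X \<phi>" and f: "f \<in> vecs H"
  shows "\<parallel>calc \<phi> f\<parallel>\<^sup>2 = Re \<langle>calc (\<lambda>t. \<phi> t * \<phi> t) f, f\<rangle>"
  using self_adjointD(2)[OF calc_self_adjoint[OF \<phi>] calc_mem[OF \<phi>] f]
  by (simp add: calc_mult[OF \<phi> \<phi> f] vnorm_squared calc_mem[OF \<phi>])

end

section \<open>Powers of positive operators\<close>

definition positive :: "'w operator \<Rightarrow> bool" where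
  "positive T \<longleftrightarrow> self_adjoint T \<and> (\<forall>f\<in>vecs H. 0 \<le> Re \<langle>T f, f\<rangle>)"

lemma positiveD:
  assumes "positive T"
  shows "self_adjoint T" "T \<in> bounded_operators H" "f \<in> vecs H \<Longrightarrow> 0 \<le> Re \<langle>T f, f\<rangle>"
  using assms by (auto simp: positive_def dest: self_adjointD(1))

lemma real_spectrum_positive:
  assumes T: "positive T" and M: "operator_norm H T \<le> M"
  shows "real_spectrum T \<subseteq> {0..M}"
proof
  fix t assume t: "t \<in> real_spectrum T"
  have "0 \<le> t"
    by (rule real_spectrum_lower[OF positiveD(1)[OF T] _ t]) (simp add: positiveD(3)[OF T])
  moreover have "t \<le> M"
    using real_spectrum_upper[OF positiveD(1)[OF T] t] M by simp
  ultimately show "t \<in> {0..M}" by simp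
qed

lemma continuous_on_powr_nonneg:
  "s > 0 \<Longrightarrow> continuous_on {0..M} (\<lambda>t::real. t powr s)"
  by (intro continuous_on_powr' continuous_intros) auto

lemma operator_powr_positive:
  assumes T: "positive T" and s: "s > 0"
  shows "positive (operator_powr H T s)"
proof -
  note X = positiveD(1)[OF T] compact_Icc real_spectrum_positive[OF T order_refl]
  note cont = continuous_on_powr_nonneg[OF s]
  show ?thesis
    unfolding positive_def operator_powr_def
    using calc_self_adjoint[OF X cont] calc_nonneg[OF X cont] by simp
qed

lemma operator_powr_double:
  assumes T: "positive T" and s: "s > 0" and f: "f \<in> vecs H"
  shows "operator_powr H T (2 * s) f = operator_powr H T s (operator_powr H T s f)"
proof -
  note X = positiveD(1)[OF T] compact_Icc real_spectrum_positive[OF T order_refl]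
  note cont = continuous_on_powr_nonneg[OF s]
  have "(\<lambda>t::real. t powr (2 * s)) = (\<lambda>t. t powr s * t powr s)"
    by (simp flip: powr_add)
  then show ?thesis
    unfolding operator_powr_def using calc_mult[OF X cont cont f] by (simp only:)
qed

text \<open>
  Convexity gives the tangent inequality for \<open>t > 0\<close>; at \<open>t = 0\<close> the left side is
  \<open>(1 - r) * a powr r \<le> 0\<close>.
\<close>

lemma powr_above_tangent:
  fixes a t r :: real
  assumes "a > 0" "t \<ge> 0" "r \<ge> 1"
  shows "a powr r + r * a powr (r - 1) * (t - a) \<le> t powr r"
proof (cases "t = 0")
  case True
  have "a powr (r - 1) * a = a powr r"
    using assms by (simp add: powr_diff)
  then have "a powr r + r * a powr (r - 1) * (t - a) = (1 - r) * a powr r"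
    using True by (simp add: algebra_simps)
  then show ?thesis
    using assms True by (simp add: mult_nonpos_nonneg)
next
  case False
  have "r * a powr (r - 1) * (t - a) \<le> t powr r - a powr r"
    using assms False
    by (intro convex_on_imp_above_tangent[where A = "{0<..}" and f = "\<lambda>x. x powr r"]
        powr_convex DERIV_subset[OF has_real_derivative_powr]) (auto simp: interior_open)
  then show ?thesis by simp
qed

text \<open>
  The graph of \<open>t powr r\<close> lies above its tangent at \<open>a = \<langle>T f, f\<rangle>\<close>.  Monotonicity of the functional
  calculus turns this into an inequality of quadratic forms, and the linear term of the tangent
  vanishes at the unit vector \<open>f\<close>.
\<close>

lemma McCarthy:
  assumes T: "positive T" and r: "r \<ge> 1" and f: "f \<in> vecs H" and unit: "\<parallel>f\<parallel> = 1"
  shows "Re \<langle>T f, f\<rangle> powr r \<le> Re \<langle>operator_powr H T r f, f\<rangle>"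
proof (cases "Re \<langle>T f, f\<rangle> = 0")
  case True
  then show ?thesis
    using positiveD(3)[OF operator_powr_positive[OF T] f] r by simp
next
  case False
  define a where "a = Re \<langle>T f, f\<rangle>"
  have a: "a > 0"
    using False positiveD(3)[OF T f] by (simp add: a_def)
  define p where "p = [:a powr r - r * a powr (r - 1) * a, r * a powr (r - 1):]"
  note TB = positiveD(2)[OF T]
  note X = positiveD(1)[OF T] compact_Icc real_spectrum_positive[OF T order_refl]
  have "Re \<langle>functional_calculus H (poly p) T f, f\<rangle> \<le> Re \<langle>operator_powr H T r f, f\<rangle>"
    unfolding operator_powr_def
  proof (rule calc_mono[OF X _ _ _ f])
    show "continuous_on {0..operator_norm H T} (poly p)"
      by (intro continuous_intros)
    show "continuous_on {0..operator_norm H T} (\<lambda>t. t powr r)"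
      using r by (intro continuous_on_powr_nonneg) simp
    show "poly p t \<le> t powr r" if "t \<in> {0..operator_norm H T}" for t
      using powr_above_tangent[OF a _ r, of t] that by (simp add: p_def algebra_simps)
  qed
  moreover have "Re \<langle>functional_calculus H (poly p) T f, f\<rangle> = a powr r"
  proof -
    have "Re \<langle>f, f\<rangle> = 1"
      using vnorm_squared[OF f] unit by simp
    then show ?thesis
      unfolding calc_poly[OF X refl f] p_def poly_operator_linear[OF TB f]
      using f by (simp add: iprod_linear bo_mem[OF TB] a_def[symmetric] del: of_real_diff of_real_mult)
  qed
  ultimately show ?thesis
    by (simp add: a_def)
qed

section \<open>The mixed Schwarz inequality\<close>

lemma adj_comp_positive:
  assumes A: "A \<in> bounded_operators H"
  shows "positive (adj H A \<circ> A)"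
proof -
  have "0 \<le> Re \<langle>adj H A (A f), f\<rangle>" if "f \<in> vecs H" for f
    using that by (simp add: adj[OF A] bo_mem[OF A] iprod_nonneg)
  then show ?thesis
    unfolding positive_def self_adjoint_def
    by (simp add: bo_comp[OF adj(1)[OF A] A] adj[OF A] bo_mem[OF A])
qed

lemma operator_abs_positive:
  assumes A: "A \<in> bounded_operators H"
  shows "positive (operator_abs H A)"
  unfolding operator_abs_def by (rule operator_powr_positive[OF adj_comp_positive[OF A]]) simp

text \<open>
  Without a polar decomposition: put \<open>S = A\<^sup>* A\<close>, \<open>T = A A\<^sup>*\<close>, and for \<open>d > 0\<close> let
  \<open>g(t) = sqrt (sqrt t + d)\<close> and \<open>h = 1 / g\<close>.  Then
  \<open>\<langle>A x, y\<rangle> = \<langle>h(S) g(S) x, A\<^sup>* y\<rangle> = \<langle>g(S) x, h(S) A\<^sup>* y\<rangle>\<close>.  Here \<open>\<parallel>g(S) x\<parallel>\<^sup>2 = \<langle>\<bar>A\<bar> x, x\<rangle> + d \<parallel>x\<parallel>\<^sup>2\<close>, and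
  since \<open>A\<close> intertwines functions of \<open>S\<close> and \<open>T\<close>, \<open>\<parallel>h(S) A\<^sup>* y\<parallel>\<^sup>2\<close> is the quadratic form at \<open>y\<close> of the
  function \<open>t / (sqrt t + d) \<le> sqrt t\<close> of \<open>T\<close>.  Cauchy-Schwarz and \<open>d \<rightarrow> 0\<close> give the claim.
\<close>

lemma mixed_Schwarz:
  assumes A: "A \<in> bounded_operators H" and x: "x \<in> vecs H" and y: "y \<in> vecs H"
  shows "(cmod \<langle>A x, y\<rangle>)\<^sup>2 \<le> Re \<langle>operator_abs H A x, x\<rangle> * Re \<langle>operator_abs H (adj H A) y, y\<rangle>"
proof -
  note A' = adj(1)[OF A]
  let ?B = "adj H A"
  define S where "S = ?B \<circ> A"
  define T where "T = A \<circ> ?B"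
  have S: "positive S"
    unfolding S_def by (rule adj_comp_positive[OF A])
  have T: "positive T"
    using adj_comp_positive[OF A'] unfolding T_def adj_adj[OF A] .
  define M where "M = max (operator_norm H S) (operator_norm H T)"
  let ?X = "{0..M}"
  note XS = positiveD(1)[OF S] compact_Icc real_spectrum_positive[OF S, of M, unfolded M_def, OF max.cobounded1, folded M_def]
  note XT = positiveD(1)[OF T] compact_Icc real_spectrum_positive[OF T, of M, unfolded M_def, OF max.cobounded2, folded M_def]
  let ?root = "\<lambda>t::real. t powr (1 / 2)"
  have root: "continuous_on ?X ?root"
    by (rule continuous_on_powr_nonneg) simp
  define a where "a = Re \<langle>operator_abs H A x, x\<rangle>"
  define b where "b = Re \<langle>operator_abs H ?B y, y\<rangle>"
  have a: "a = Re \<langle>functional_calculus H ?root S x, x\<rangle>"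
    by (simp add: a_def operator_abs_def operator_powr_def S_def)
  have b: "b = Re \<langle>functional_calculus H ?root T y, y\<rangle>"
    by (simp add: b_def operator_abs_def operator_powr_def T_def adj_adj[OF A])
  have b_nonneg: "b \<ge> 0"
    unfolding b_def by (rule positiveD(3)[OF operator_abs_positive[OF A'] y])
  have key: "(cmod \<langle>A x, y\<rangle>)\<^sup>2 \<le> (a + d * \<parallel>x\<parallel>\<^sup>2) * b" if d: "d > 0" for d
  proof -
    define g where "g t = sqrt (?root t + d)" for t
    define h where "h t = 1 / g t" for t
    have g_pos: "g t > 0" for t
      using d by (simp add: g_def add_nonneg_pos)
    have g: "continuous_on ?X g"
      unfolding g_def by (intro continuous_intros root)
    have h: "continuous_on ?X h"
      unfolding h_def using g_pos by (intro continuous_intros g) (simp add: less_imp_neq[symmetric])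
    have gg: "g t * g t = ?root t + d" for t
      using d by (simp add: g_def add_nonneg_nonneg)
    have hh: "h t * h t = 1 / (?root t + d)" for t
      by (simp add: h_def flip: gg)
    let ?g = "functional_calculus H g S x"
    let ?h = "functional_calculus H h S (?B y)"
    have By: "?B y \<in> vecs H" by (rule bo_mem[OF A'])
    have "functional_calculus H (\<lambda>t. h t * g t) S x = poly_operator H [:1:] S x"
      using g_pos by (intro calc_poly[OF XS _ x]) (simp add: h_def less_imp_neq[symmetric])
    also have "\<dots> = x"
      unfolding poly_operator_const[OF positiveD(2)[OF S] x] by (simp add: fscale_1)
    finally have hg: "functional_calculus H h S ?g = x"
      unfolding calc_mult[OF XS h g x] .
    have "\<langle>A x, y\<rangle> = \<langle>functional_calculus H h S ?g, ?B y\<rangle>"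
      unfolding hg by (rule adj(2)[OF A x y, symmetric])
    also have "\<dots> = \<langle>?g, ?h\<rangle>"
      by (rule self_adjointD(2)[OF calc_self_adjoint[OF XS h] calc_mem[OF XS g] By])
    finally have "cmod \<langle>A x, y\<rangle> \<le> \<parallel>?g\<parallel> * \<parallel>?h\<parallel>"
      using Cauchy_Schwarz[OF calc_mem[OF XS g] calc_mem[OF XS h], of x "?B y"] by simp
    then have "(cmod \<langle>A x, y\<rangle>)\<^sup>2 \<le> (\<parallel>?g\<parallel> * \<parallel>?h\<parallel>)\<^sup>2"
      by (rule power_mono) simp
    then have le: "(cmod \<langle>A x, y\<rangle>)\<^sup>2 \<le> \<parallel>?g\<parallel>\<^sup>2 * \<parallel>?h\<parallel>\<^sup>2"
      by (simp only: power_mult_distrib)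
    have norm_g: "\<parallel>?g\<parallel>\<^sup>2 = a + d * \<parallel>x\<parallel>\<^sup>2"
    proof -
      have const: "functional_calculus H (\<lambda>_. d) S x = fscale (complex_of_real d) x"
        using calc_poly[OF XS _ x, of "\<lambda>_. d" "[:d:]"] poly_operator_const[OF positiveD(2)[OF S] x, of d]
        by simp
      have "?root = (\<lambda>t. g t * g t - d)"
        by (rule ext) (simp add: gg)
      then have "functional_calculus H ?root S x =
          functional_calculus H (\<lambda>t. g t * g t) S x - fscale (complex_of_real d) x"
        using calc_diff[OF XS continuous_on_mult[OF g g] continuous_on_const x, of d] const by (simp only:)
      then show ?thesis
        unfolding calc_norm_squared[OF XS g x] a
        using x calc_mem[OF XS continuous_on_mult[OF g g], of x]
        by (simp add: iprod_linear vnorm_squared)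
    qed
    have norm_h: "\<parallel>?h\<parallel>\<^sup>2 \<le> b"
    proof -
      have w: "continuous_on ?X (\<lambda>t. h t * h t)"
        using h h by (rule continuous_on_mult)
      have id: "functional_calculus H (\<lambda>t. t) T y = T y"
        using calc_poly[OF XT _ y, of "\<lambda>t. t" "[:0, 1:]"] poly_operator_linear[OF positiveD(2)[OF T] y, of 0 1]
        by (simp add: fscale_0 fscale_1)
      have "\<parallel>?h\<parallel>\<^sup>2 = Re \<langle>functional_calculus H (\<lambda>t. h t * h t) S (?B y), ?B y\<rangle>"
        by (rule calc_norm_squared[OF XS h By])
      also have "\<dots> = Re \<langle>A (functional_calculus H (\<lambda>t. h t * h t) S (?B y)), y\<rangle>"
        using adj(2)[OF A calc_mem[OF XS w] y] by simp
      also have "A (functional_calculus H (\<lambda>t. h t * h t) S (?B y)) =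
          functional_calculus H (\<lambda>t. h t * h t) T (A (?B y))"
        by (rule functional_calculus_intertwine[OF A XS(1) XT(1) _ XS(2,3) XT(3) w By, symmetric])
          (simp add: S_def T_def)
      also have "A (?B y) = functional_calculus H (\<lambda>t. t) T y"
        unfolding id by (simp add: T_def)
      also have "functional_calculus H (\<lambda>t. h t * h t) T (functional_calculus H (\<lambda>t. t) T y) =
          functional_calculus H (\<lambda>t. h t * h t * t) T y"
        by (rule calc_mult[OF XT w continuous_on_id y, symmetric])
      also have "Re \<langle>functional_calculus H (\<lambda>t. h t * h t * t) T y, y\<rangle> \<le> b"
        unfolding b
      proof (rule calc_mono[OF XT _ root _ y])
        show "continuous_on ?X (\<lambda>t. h t * h t * t)"
          by (intro continuous_intros w)
        fix t assume t: "t \<in> ?X"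
        then have "t = ?root t * ?root t"
          by (simp flip: powr_add)
        also have "\<dots> \<le> ?root t * (?root t + d)"
          using d by (intro mult_left_mono) simp_all
        finally show "h t * h t * t \<le> ?root t"
          unfolding hh using d by (simp add: pos_divide_le_eq add_nonneg_pos)
      qed
      finally show ?thesis .
    qed
    have "\<parallel>?g\<parallel>\<^sup>2 * \<parallel>?h\<parallel>\<^sup>2 \<le> \<parallel>?g\<parallel>\<^sup>2 * b"
      using norm_h by (rule mult_left_mono) simp
    with le show ?thesis
      unfolding norm_g by linarith
  qed
  have "((\<lambda>d. (a + d * \<parallel>x\<parallel>\<^sup>2) * b) \<longlongrightarrow> (a + 0 * \<parallel>x\<parallel>\<^sup>2) * b) (at_right 0)"
    by (intro tendsto_intros)
  then have "(cmod \<langle>A x, y\<rangle>)\<^sup>2 \<le> (a + 0 * \<parallel>x\<parallel>\<^sup>2) * b"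
    by (rule tendsto_lowerbound) (auto simp: eventually_at_right_field intro!: key exI[of _ 1])
  then show ?thesis
    by (simp add: a_def b_def)
qed

section \<open>The Buzano inequality and the pointwise estimate\<close>

text \<open>
  The reflection \<open>z = 2 \<langle>x, e\<rangle> e - x\<close> of \<open>x\<close> has the norm of \<open>x\<close>, and
  \<open>\<langle>z, y\<rangle> = 2 \<langle>x, e\<rangle> \<langle>e, y\<rangle> - \<langle>x, y\<rangle>\<close>; apply Cauchy-Schwarz to \<open>\<langle>z, y\<rangle>\<close>.
\<close>

lemma Buzano:
  assumes x: "x \<in> vecs H" and y: "y \<in> vecs H" and e: "e \<in> vecs H" and unit: "\<parallel>e\<parallel> = 1"
  shows "cmod \<langle>x, e\<rangle> * cmod \<langle>e, y\<rangle> \<le> (\<parallel>x\<parallel> * \<parallel>y\<parallel> + cmod \<langle>x, y\<rangle>) / 2"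
proof -
  define c where "c = \<langle>x, e\<rangle>"
  define z where "z = fscale (complex_of_real 2) (fscale c e) - x"
  have c: "c \<in> scalars H" using x e by (simp add: c_def iprod_scalar)
  have z: "z \<in> vecs H"
    unfolding z_def using x e c by (intro diff_mem scale_mem of_real_scalar)
  have ee: "\<langle>e, e\<rangle> = 1" using iprod_self[OF e] unit by simp
  have ex: "\<langle>e, x\<rangle> = cnj c" unfolding c_def by (rule iprod_cnj[OF x e])
  have mem: "fscale c e \<in> vecs H" "fscale (complex_of_real 2) (fscale c e) \<in> vecs H"
    using e c by (intro scale_mem of_real_scalar; simp)+
  have zy: "\<langle>z, y\<rangle> = 2 * (c * \<langle>e, y\<rangle>) - \<langle>x, y\<rangle>"
    unfolding z_def iprod_diff(1)[OF mem(2) x y] iprod_scale[OF of_real_scalar mem(1) y]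
      iprod_scale[OF c e y] by simp
  have "\<langle>z, z\<rangle> = \<langle>x, x\<rangle>"
    unfolding z_def iprod_diff(1)[OF mem(2) x diff_mem[OF mem(2) x]] iprod_diff(2)[OF mem(2) x mem(2)]
      iprod_diff(2)[OF mem(2) x x]
      iprod_scale[OF of_real_scalar mem(1) mem(2)] iprod_scale[OF of_real_scalar mem(1) x]
      iprod_scale_right[OF of_real_scalar mem(1) mem(1)] iprod_scale_right[OF of_real_scalar x mem(1)]
      iprod_scale[OF c e mem(1)] iprod_scale_right[OF c e e] iprod_scale[OF c e x] iprod_scale_right[OF c x e]
      ee ex c_def[symmetric]
    by simp
  then have "\<parallel>z\<parallel> = \<parallel>x\<parallel>"
    by (simp add: vnorm_def)
  then have "cmod (2 * (c * \<langle>e, y\<rangle>) - \<langle>x, y\<rangle>) \<le> \<parallel>x\<parallel> * \<parallel>y\<parallel>"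
    using Cauchy_Schwarz[OF z y] by (simp add: zy)
  moreover have "cmod (2 * (c * \<langle>e, y\<rangle>)) \<le> cmod (2 * (c * \<langle>e, y\<rangle>) - \<langle>x, y\<rangle>) + cmod \<langle>x, y\<rangle>"
    using norm_triangle_ineq[of "2 * (c * \<langle>e, y\<rangle>) - \<langle>x, y\<rangle>" "\<langle>x, y\<rangle>"] by simp
  ultimately show ?thesis
    by (simp add: norm_mult c_def)
qed

lemma quadratic_form_estimate:
  assumes A: "A \<in> bounded_operators H" and r: "r \<ge> 1" and e: "e \<in> vecs H" and unit: "\<parallel>e\<parallel> = 1"
  defines "B \<equiv> operator_abs H A" and "C \<equiv> operator_abs H (adj H A)"
  shows "cmod \<langle>A e, e\<rangle> powr (2 * r) \<le>
    1 / 4 * cmod \<langle>(operator_powr H B (2 * r) + operator_powr H C (2 * r)) e, e\<rangle>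
    + 1 / 2 * cmod \<langle>(operator_powr H B r \<circ> operator_powr H C r) e, e\<rangle>"
proof -
  have r0: "r > 0" using r by simp
  have B: "positive B" unfolding B_def by (rule operator_abs_positive[OF A])
  have C: "positive C" unfolding C_def by (rule operator_abs_positive[OF adj(1)[OF A]])
  let ?P = "operator_powr H B r" and ?Q = "operator_powr H C r"
  have P: "self_adjoint ?P" "?P \<in> bounded_operators H"
    using positiveD[OF operator_powr_positive[OF B r0]] by auto
  have Q: "self_adjoint ?Q" "?Q \<in> bounded_operators H"
    using positiveD[OF operator_powr_positive[OF C r0]] by auto
  have mem: "?P e \<in> vecs H" "?Q e \<in> vecs H"
    using P(2) Q(2) by (simp_all add: bo_mem)
  let ?b = "Re \<langle>B e, e\<rangle>" and ?c = "Re \<langle>C e, e\<rangle>"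
  have bc: "?b \<ge> 0" "?c \<ge> 0"
    using positiveD(3)[OF B e] positiveD(3)[OF C e] .
  have "cmod \<langle>A e, e\<rangle> powr (2 * r) = ((cmod \<langle>A e, e\<rangle>)\<^sup>2) powr r"
    by (cases "cmod \<langle>A e, e\<rangle> = 0") (simp_all add: powr_powr flip: powr_numeral)
  also have "\<dots> \<le> (?b * ?c) powr r"
    using mixed_Schwarz[OF A e e] r0 unfolding B_def C_def by (intro powr_mono2) simp_all
  also have "\<dots> = ?b powr r * ?c powr r"
    using bc by (simp add: powr_mult)
  also have "\<dots> \<le> Re \<langle>?P e, e\<rangle> * Re \<langle>?Q e, e\<rangle>"
    using McCarthy[OF B r e unit] McCarthy[OF C r e unit] positiveD(3)[OF operator_powr_positive[OF B r0] e]
    by (intro mult_mono) simp_all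
  also have "\<dots> \<le> cmod \<langle>?P e, e\<rangle> * cmod \<langle>?Q e, e\<rangle>"
    using positiveD(3)[OF operator_powr_positive[OF C r0] e]
    by (intro mult_mono complex_Re_le_cmod) simp_all
  also have "\<langle>?Q e, e\<rangle> = \<langle>e, ?Q e\<rangle>"
    by (rule self_adjointD(2)[OF Q(1) e e])
  also have "cmod \<langle>?P e, e\<rangle> * cmod \<langle>e, ?Q e\<rangle> \<le> (\<parallel>?P e\<parallel> * \<parallel>?Q e\<parallel> + cmod \<langle>?P e, ?Q e\<rangle>) / 2"
    by (rule Buzano[OF mem e unit])
  also have "cmod \<langle>?P e, ?Q e\<rangle> = cmod \<langle>(?P \<circ> ?Q) e, e\<rangle>"
  proof -
    have "\<langle>?P e, ?Q e\<rangle> = cnj \<langle>?P (?Q e), e\<rangle>"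
      using self_adjointD(2)[OF P(1) e mem(2)] iprod_cnj[of "?P (?Q e)" e] e bo_mem[OF P(2)] by simp
    then show ?thesis by simp
  qed
  also have "\<parallel>?P e\<parallel> * \<parallel>?Q e\<parallel> \<le> (\<parallel>?P e\<parallel>\<^sup>2 + \<parallel>?Q e\<parallel>\<^sup>2) / 2"
    using sum_squares_bound[of "\<parallel>?P e\<parallel>" "\<parallel>?Q e\<parallel>"] by simp
  also have "\<parallel>?P e\<parallel>\<^sup>2 + \<parallel>?Q e\<parallel>\<^sup>2 =
      Re \<langle>(operator_powr H B (2 * r) + operator_powr H C (2 * r)) e, e\<rangle>"
    using self_adjointD(2)[OF P(1) mem(1) e] self_adjointD(2)[OF Q(1) mem(2) e] mem e
    by (simp add: fun_apply operator_powr_double[OF B r0 e] operator_powr_double[OF C r0 e] iprod_linear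
        vnorm_squared bo_mem[OF P(2)] bo_mem[OF Q(2)])
  also have "\<dots> \<le> cmod \<langle>(operator_powr H B (2 * r) + operator_powr H C (2 * r)) e, e\<rangle>"
    by (rule complex_Re_le_cmod)
  finally show ?thesis
    by (simp add: field_simps)
qed

end

section \<open>Berezin numbers\<close>

context rkhs
begin

lemma repr_kernel_mem:
  assumes x: "x \<in> points H"
  shows "repr_kernel H x \<in> vecs H"
proof -
  let ?P = "\<lambda>k. k \<in> vecs H \<and> (\<forall>f\<in>vecs H. f x = \<langle>f, k\<rangle>)"
  obtain C where C: "\<And>f. f \<in> vecs H \<Longrightarrow> cmod (f x) \<le> C * \<parallel>f\<parallel>"
    using evaluation_bounded[OF x] by blast
  have "\<exists>k\<in>vecs H. \<forall>f\<in>vecs H. f x = \<langle>f, k\<rangle>"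
    by (rule Riesz_representation[OF _ _ _ C]) (simp_all add: vecs_values x fscale_def fun_apply)
  moreover have "k = l" if "?P k" "?P l" for k l
    using that by (intro eq_if_iprod_eq[of k l]) auto
  ultimately have "\<exists>!k. ?P k" by blast
  then have "?P (repr_kernel H x)"
    unfolding repr_kernel_def by (rule theI')
  then show ?thesis by blast
qed

lemma normalized_kernel:
  assumes "x \<in> points H" "repr_kernel H x \<noteq> 0"
  shows "normalized_kernel H x \<in> vecs H" "\<parallel>normalized_kernel H x\<parallel> = 1"
proof -
  note k = repr_kernel_mem[OF assms(1)]
  have pos: "\<parallel>repr_kernel H x\<parallel> > 0"
    using vnorm_eq_zero[OF k] vnorm_nonneg[OF k] assms(2) by linarith
  show "normalized_kernel H x \<in> vecs H"
    unfolding normalized_kernel_def by (rule scale_mem[OF of_real_scalar k])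
  show "\<parallel>normalized_kernel H x\<parallel> = 1"
    unfolding normalized_kernel_def vnorm_scale[OF of_real_scalar k] norm_of_real using pos by simp
qed

lemma ber_upper:
  assumes T: "T \<in> bounded_operators H" and nz: "\<forall>x\<in>points H. repr_kernel H x \<noteq> 0" and x: "x \<in> points H"
  shows "cmod \<langle>T (normalized_kernel H x), normalized_kernel H x\<rangle> \<le> ber H T"
  unfolding ber_def
proof (rule cSUP_upper[OF x bdd_aboveI2])
  fix y assume y: "y \<in> points H"
  note k = normalized_kernel[OF y bspec[OF nz y]]
  show "cmod \<langle>T (normalized_kernel H y), normalized_kernel H y\<rangle> \<le> operator_norm H T"
    using Cauchy_Schwarz[OF bo_mem[OF T] k(1), of "normalized_kernel H y"]
      operator_norm_bound[OF T k(1)] k(2) by simp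
qed

end

theorem theorem2p15:
  fixes H :: "'w function_space" and A :: "'w operator" and r :: real
  assumes "rkhs H"
    and "\<forall>x\<in>points H. repr_kernel H x \<noteq> 0"
    and "A \<in> bounded_operators H"
    and "r \<ge> 1"
  shows "ber H A powr (2 * r) \<le>
    1 / 4 * ber H (operator_powr H (operator_abs H A) (2 * r)
                   + operator_powr H (operator_abs H (adj H A)) (2 * r))
    + 1 / 2 * ber H (operator_powr H (operator_abs H A) r
                     \<circ> operator_powr H (operator_abs H (adj H A)) r)"
proof -
  interpret rkhs H by (rule assms(1))
  note nz = assms(2) and A = assms(3)
  let ?U = "operator_powr H (operator_abs H A) (2 * r) + operator_powr H (operator_abs H (adj H A)) (2 * r)"
  let ?V = "operator_powr H (operator_abs H A) r \<circ> operator_powr H (operator_abs H (adj H A)) r"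
  let ?R = "1 / 4 * ber H ?U + 1 / 2 * ber H ?V"
  have powr_bo: "operator_powr H (operator_abs H D) s \<in> bounded_operators H"
    if "D \<in> bounded_operators H" "s > 0" for D s
    using positiveD(2)[OF operator_powr_positive[OF operator_abs_positive[OF that(1)] that(2)]] .
  have U: "?U \<in> bounded_operators H" and V: "?V \<in> bounded_operators H"
    using assms(4) by (intro bo_plus bo_comp powr_bo A adj(1)[OF A]; simp)+
  have point: "cmod \<langle>A (normalized_kernel H x), normalized_kernel H x\<rangle> powr (2 * r) \<le> ?R"
    if x: "x \<in> points H" for x
    using quadratic_form_estimate[OF A assms(4) normalized_kernel[OF x bspec[OF nz x]]]
      ber_upper[OF U nz x] ber_upper[OF V nz x] by linarith
  obtain x0 where x0: "x0 \<in> points H" using points_nonempty by blast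
  have R: "?R \<ge> 0"
    using point[OF x0] powr_ge_zero order_trans by blast
  have "ber H A \<le> ?R powr (1 / (2 * r))"
    unfolding ber_def[of H A]
  proof (rule cSUP_least[OF points_nonempty])
    fix x assume x: "x \<in> points H"
    let ?c = "cmod \<langle>A (normalized_kernel H x), normalized_kernel H x\<rangle>"
    have "?c = (?c powr (2 * r)) powr (1 / (2 * r))"
      using assms(4) by (simp add: powr_powr)
    also have "\<dots> \<le> ?R powr (1 / (2 * r))"
      using point[OF x] assms(4) by (intro powr_mono2) simp_all
    finally show "?c \<le> ?R powr (1 / (2 * r))" .
  qed
  moreover have "0 \<le> ber H A"
    using ber_upper[OF A nz x0] norm_ge_zero order_trans by blast
  ultimately have "ber H A powr (2 * r) \<le> (?R powr (1 / (2 * r))) powr (2 * r)"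
    using assms(4) by (intro powr_mono2) simp_all
  also have "\<dots> = ?R"
    using assms(4) R by (simp add: powr_powr)
  finally show ?thesis .
qed

end
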